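(* Without any extra set-theoretic hypothesis, the increasing difference hierarchy of coanalytic sets is strictly included in the $\omega$-th level of the decreasing difference hierarchy of coanalytic sets; that is, $$\mathsf{Diff}(\boldsymbol{\Pi}^1_1)\subsetneq\Delta(D^\ast_\omega(\boldsymbol{\Pi}^1_1))$$ holds, constructively.
   Context: Sets are subsets of Baire space $\omega^\omega$. For an ordinal $\xi=\lambda+n$ with $\lambda$ zero or limit and $n<\omega$, $\mathsf{par}(\xi)=1$ if $n$ is odd and $\mathsf{par}(\xi)=0$ if $n$ is even. For a countable ordinal $\xi$ and an increasing sequence $(A_\eta)_{\eta<\xi}$ of sets, $$\mathbb{D}_{\eta<\xi}A_\eta=\bigcup_{\eta<\xi,\ \mathsf{par}(\eta)\neq\mathsf{par}(\xi)}\Big(A_\eta\setminus\bigcup_{\gamma<\eta}A_\gamma\Big).$$ $D_\xi(\boldsymbol{\Pi}^1_1)$ is the class of all sets $\mathbb{D}_{\eta<\xi}A_\eta$ for increasing sequences of $\boldsymbol{\Pi}^1_1$ subsets of $\omega^\omega$, and $\mathsf{Diff}(\boldsymbol{\Pi}^1_1)=\bigcup_{\xi<\omega_1}D_\xi(\boldsymbol{\Pi}^1_1)$. For a decreasing sequence $(B_n)_{n<\omega}$, $\mathbb{D}^\ast_{n<\omega}B_n=\bigcup_{n\text{ even}}(B_n\setminus B_{n+1})$; $D^\ast_\omega(\boldsymbol{\Pi}^1_1)$ is the class of all such sets with every $B_n$ being $\boldsymbol{\Pi}^1_1$. For a class $\Gamma$, $\neg\Gamma$ is the class of complements of sets in $\Gamma$,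 and $\Delta(\Gamma)=\Gamma\cap\neg\Gamma$. The word "constructively" is used informally: the properness of the inclusion is witnessed by an explicitly given natural set. That set is (the set with characteristic function) the map sending $(x,y)$ to the parity of the $\le_y$-rank of the $\le_y$-least element of $P_x$ if $y$ codes a well-order $\le_y$ on $\omega$ and $P_x\neq\emptyset$, and to $0$ otherwise, where $P_x\subseteq\omega$ is the $\boldsymbol{\Pi}^1_1$ set coded by $x\in\omega^\omega$. *)

theory Defs
  imports "HOL-Analysis.Analysis" "HOL-Library.Countable_Set_Type" "HOL-Library.Nat_Bijection"
begin

section \<open>Countable ordinals\<close>

text \<open>The elements of \<open>omega1\<close>, with their order, are the ordinals below
  \<open>\<omega>\<^sub>1 = cardSuc natLeq\<close>, that is, the countable ordinals.\<close>

typedef omega1 = "Field (cardSuc natLeq)"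
proof -
  have "infinite (Field (cardSuc natLeq))"
    using cardSuc_finite[OF natLeq_Card_order] by (simp add: Field_natLeq)
  then show "\<exists>x. x \<in> Field (cardSuc natLeq)"
    using infinite_imp_nonempty by blast
qed

lemma Well_order_cardSuc_natLeq: "Well_order (cardSuc natLeq)"
  using cardSuc_Card_order[OF natLeq_Card_order] card_order_on_well_order_on by blast

instantiation omega1 :: wellorder
begin

definition less_eq_omega1 :: "omega1 \<Rightarrow> omega1 \<Rightarrow> bool" where
  "\<xi> \<le> \<eta> \<longleftrightarrow> (Rep_omega1 \<xi>, Rep_omega1 \<eta>) \<in> cardSuc natLeq"

definition less_omega1 :: "omega1 \<Rightarrow> omega1 \<Rightarrow> bool" where
  "(\<xi>::omega1) < \<eta> \<longleftrightarrow> \<xi> \<le> \<eta> \<and> \<not> \<eta> \<le> \<xi>"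

instance
proof -
  let ?r = "cardSuc natLeq"
  have wo: "well_order_on (Field ?r) ?r"
    by (rule Well_order_cardSuc_natLeq)
  then have lin: "linear_order_on (Field ?r) ?r" and wf: "wf (?r - Id)"
    by (simp_all add: well_order_on_def)
  then have part: "partial_order_on (Field ?r) ?r" and to: "total_on (Field ?r) ?r"
    by (simp_all add: linear_order_on_def)
  then have pre: "preorder_on (Field ?r) ?r" and an: "antisym ?r"
    by (simp_all add: partial_order_on_def)
  then have re: "refl_on (Field ?r) ?r" and tr: "trans ?r"
    by (simp_all add: preorder_on_def)
  have rf: "(Rep_omega1 x, Rep_omega1 x) \<in> ?r" for x
    by (rule refl_onD[OF re Rep_omega1])
  have anti: "x = y" if "x \<le> y" "y \<le> x" for x y :: omega1
    using that antisymD[OF an, of "Rep_omega1 x" "Rep_omega1 y"]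
    by (simp add: less_eq_omega1_def Rep_omega1_inject)
  have wf': "wf {(x, y). (x::omega1) < y}"
    by (rule wf_subset[OF wf_inv_image[OF wf, of Rep_omega1]])
       (auto simp: inv_image_def less_omega1_def less_eq_omega1_def rf)
  show "OFCLASS(omega1, wellorder_class)"
  proof (intro_classes)
    fix x y z :: omega1
    show "(x < y) = (x \<le> y \<and> \<not> y \<le> x)" by (rule less_omega1_def)
    show "x \<le> x" using rf by (simp add: less_eq_omega1_def)
    show "x \<le> y \<Longrightarrow> y \<le> z \<Longrightarrow> x \<le> z"
      unfolding less_eq_omega1_def by (rule transD[OF tr])
    show "x \<le> y \<Longrightarrow> y \<le> x \<Longrightarrow> x = y" by (rule anti)
    show "x \<le> y \<or> y \<le> x"
      using to[unfolded total_on_def, rule_format, OF Rep_omega1[of x] Rep_omega1[of y]] rf[of x]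
      by (cases "x = y") (auto simp: less_eq_omega1_def Rep_omega1_inject)
  next
    fix P :: "omega1 \<Rightarrow> bool" and a
    assume "\<And>x. (\<And>y. y < x \<Longrightarrow> P y) \<Longrightarrow> P x"
    then show "P a" using wf_induct_rule[OF wf', of P a] by auto
  qed
qed

end

context
  includes cardinal_syntax
begin

lemma countable_lessThan_omega1: "countable {..<\<xi>::omega1}"
proof -
  have "|underS (cardSuc natLeq) (Rep_omega1 \<xi>)| \<le>o natLeq"
    using card_of_underS[OF cardSuc_Card_order[OF natLeq_Card_order] Rep_omega1]
      cardSuc_ordLeq_ordLess[OF natLeq_Card_order card_of_Card_order] by blast
  then have "countable (underS (cardSuc natLeq) (Rep_omega1 \<xi>))"
    by (simp add: countable_card_le_natLeq)
  moreover have "Rep_omega1 ` {..<\<xi>} \<subseteq> underS (cardSuc natLeq) (Rep_omega1 \<xi>)"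
    by (auto simp: underS_def Rep_omega1_inject less_le less_eq_omega1_def)
  ultimately have "countable (Rep_omega1 ` {..<\<xi>})" by (rule countable_subset[rotated])
  then show ?thesis
    by (rule countable_image_inj_on) (auto simp: inj_on_def Rep_omega1_inject)
qed

lemma uncountable_omega1: "uncountable (UNIV :: omega1 set)"
proof
  assume "countable (UNIV :: omega1 set)"
  then have "countable (range Rep_omega1)" by simp
  then have "|Field (cardSuc natLeq)| \<le>o natLeq"
    using type_definition.Rep_range[OF type_definition_omega1]
    by (simp add: countable_card_le_natLeq)
  then have "cardSuc natLeq \<le>o natLeq"
    using card_of_Field_ordIso[OF cardSuc_Card_order[OF natLeq_Card_order]]
      ordIso_ordLeq_trans ordIso_symmetric by blast
  then show False
    using cardSuc_greater[OF natLeq_Card_order] not_ordLess_ordLeq by blast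
qed

end

lemma omega1_greater_exists: "\<exists>\<eta>. (\<xi>::omega1) < \<eta>"
proof (rule ccontr)
  assume "\<not> ?thesis"
  then have "UNIV = insert \<xi> {..<\<xi>}" by (auto simp: not_less le_less)
  then show False using countable_lessThan_omega1[of \<xi>] uncountable_omega1
    by (metis countable_insert)
qed

definition next_ord :: "omega1 \<Rightarrow> omega1" where
  "next_ord \<xi> = (LEAST \<eta>. \<xi> < \<eta>)"

definition zero_or_limit :: "omega1 \<Rightarrow> bool" where
  "zero_or_limit \<xi> \<longleftrightarrow> (\<forall>\<eta>. \<xi> \<noteq> next_ord \<eta>)"

text \<open>The \<open>n\<close> in the decomposition \<open>\<xi> = \<mu> + n\<close>, with \<open>\<mu>\<close> zero or a limit.\<close>

definition finite_part :: "omega1 \<Rightarrow> nat" where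
  "finite_part \<xi> = (THE n. \<exists>\<mu>. zero_or_limit \<mu> \<and> \<xi> = (next_ord ^^ n) \<mu>)"

definition par :: "omega1 \<Rightarrow> nat" where
  "par \<xi> = (if odd (finite_part \<xi>) then 1 else 0)"


section \<open>Coanalytic sets and difference hierarchies\<close>

type_synonym baire = "nat \<Rightarrow> nat"

text \<open>Here \<^typ>\<open>baire\<close> carries the product topology of the discrete topology on \<^typ>\<open>nat\<close>.\<close>

definition Sigma11 :: "baire set set" where
  "Sigma11 = {fst ` C |C :: (baire \<times> baire) set. closed C}"

definition dual :: "baire set set \<Rightarrow> baire set set" where
  "dual \<Gamma> = uminus ` \<Gamma>"

definition Pi11 :: "baire set set" where
  "Pi11 = dual Sigma11"

definition Delta :: "baire set set \<Rightarrow> baire set set" where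
  "Delta \<Gamma> = \<Gamma> \<inter> dual \<Gamma>"

text \<open>In \<open>incr_diff \<xi> A\<close> only the values \<open>A \<eta>\<close> with \<open>\<eta> < \<xi>\<close> matter.\<close>

definition incr_diff :: "omega1 \<Rightarrow> (omega1 \<Rightarrow> baire set) \<Rightarrow> baire set" where
  "incr_diff \<xi> A = (\<Union>\<eta>\<in>{\<eta>. \<eta> < \<xi> \<and> par \<eta> \<noteq> par \<xi>}. A \<eta> - (\<Union>\<gamma>\<in>{..<\<eta>}. A \<gamma>))"

definition D_level :: "omega1 \<Rightarrow> baire set set \<Rightarrow> baire set set" where
  "D_level \<xi> \<Gamma> = {incr_diff \<xi> A |A. mono_on {..<\<xi>} A \<and> (\<forall>\<eta><\<xi>. A \<eta> \<in> \<Gamma>)}"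

definition Diff_class :: "baire set set \<Rightarrow> baire set set" where
  "Diff_class \<Gamma> = (\<Union>\<xi>. D_level \<xi> \<Gamma>)"

definition decr_diff :: "(nat \<Rightarrow> baire set) \<Rightarrow> baire set" where
  "decr_diff B = (\<Union>n\<in>{n. even n}. B n - B (Suc n))"

definition Dstar_omega :: "baire set set \<Rightarrow> baire set set" where
  "Dstar_omega \<Gamma> = {decr_diff B |B. decseq B \<and> (\<forall>n. B n \<in> \<Gamma>)}"


section \<open>The witness\<close>

text \<open>The set \<open>P\<^sub>x \<subseteq> \<omega>\<close> is the section at \<open>x\<close> of a universal coanalytic set:
  \<open>x\<close> determines the open set of those \<open>(n, z)\<close> some finite initial segment \<open>(n, z\<restriction>k)\<close> of which
  has a (list) code at which \<open>x\<close> does not vanish, and \<open>P\<^sub>x\<close> is the universal projection of that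
  open set along \<open>z\<close>.\<close>

definition coded_Pi11 :: "baire \<Rightarrow> nat set" where
  "coded_Pi11 x = {n. \<forall>z::baire. \<exists>k. x (list_encode (n # map z [0..<k])) \<noteq> 0}"

definition coded_rel :: "baire \<Rightarrow> nat rel" where
  "coded_rel y = {(i, j). y (prod_encode (i, j)) = 0}"

definition rank_in :: "nat rel \<Rightarrow> nat \<Rightarrow> omega1" where
  "rank_in r n =
     (THE \<xi>. (Restr r (underS r n), {(\<alpha>, \<beta>). \<alpha> \<le> \<beta> \<and> \<beta> < \<xi>}) \<in> ordIso)"

definition least_in :: "nat rel \<Rightarrow> nat set \<Rightarrow> nat" where
  "least_in r S = (THE n. n \<in> S \<and> (\<forall>m\<in>S. (n, m) \<in> r))"

definition witness_fun :: "baire \<Rightarrow> baire \<Rightarrow> nat" where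
  "witness_fun x y =
     (if well_order_on UNIV (coded_rel y) \<and> coded_Pi11 x \<noteq> {}
      then par (rank_in (coded_rel y) (least_in (coded_rel y) (coded_Pi11 x)))
      else 0)"

text \<open>A pair \<open>(x, y)\<close> is identified with the point \<open>z\<close> such that \<open>z (2 n) = x n\<close> and
  \<open>z (2 n + 1) = y n\<close>.\<close>

definition witness_set :: "baire set" where
  "witness_set = {z. witness_fun (\<lambda>n. z (2 * n)) (\<lambda>n. z (2 * n + 1)) = 1}"

end

theory Submission
  imports Defs
begin

text \<open>
  A code \<open>x\<close> attaches to each \<open>n\<close> a tree that is well-founded iff \<open>n \<in> P\<^sub>x\<close>, and the rank of this tree
  is the stage at which \<open>n\<close> enters \<open>P\<^sub>x\<close>. While the stages pass, the \<open>\<le>\<^sub>y\<close>-least element found so far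
  can only decrease, hence changes finitely often, and the value of the witness is the parity of the
  number of times its rank changes parity. Comparing stages amounts to the non-existence of a
  simulation between trees, so ``at least \<open>n\<close> changes'' is coanalytic; these sets present both the
  witness and its complement as decreasing differences.

  Conversely, for fixed \<open>\<xi>\<close>, a code of a well-order of type above \<open>\<xi>\<close> turns every set in
  \<open>D\<^sub>\<xi>\<close>, uniformly in a code \<open>w\<close> for it, into the complement of a continuous preimage of
  the witness. With \<open>w\<close> fixed this gives the inclusion; evaluating at \<open>w\<close> itself, Cantor's diagonal
  argument shows that the witness is not in \<open>D\<^sub>\<xi>\<close>.
\<close>

section \<open>Ordinals and ranks\<close>

text \<open>Otherwise \<open>omega1\<close> would be covered by \<open>S\<close> and countably many
  countable initial segments.\<close>

lemma countable_bounded_omega1: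
  assumes "countable S"
  shows "\<exists>\<beta>::omega1. \<forall>\<xi>\<in>S. \<xi> < \<beta>"
proof (rule ccontr)
  assume "\<not> ?thesis"
  then have "UNIV = S \<union> (\<Union>\<xi>\<in>S. {..<\<xi>})"
    by (force simp: not_less le_less)
  moreover have "countable (S \<union> (\<Union>\<xi>\<in>S. {..<\<xi>}))"
    using assms countable_lessThan_omega1 by auto
  ultimately show False using uncountable_omega1 by simp
qed

section \<open>Successors and parity of countable ordinals\<close>

lemma next_ord_greater: "\<xi> < next_ord \<xi>"
  unfolding next_ord_def using omega1_greater_exists[of \<xi>] by (metis LeastI_ex)

lemma next_ord_le_iff: "next_ord \<xi> \<le> \<eta> \<longleftrightarrow> \<xi> < \<eta>"
  using next_ord_greater[of \<xi>] by (auto simp: next_ord_def intro: Least_le)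

lemma next_ord_less_iff [simp]: "next_ord \<xi> < next_ord \<eta> \<longleftrightarrow> \<xi> < \<eta>"
  by (metis next_ord_le_iff next_ord_greater not_less order_less_le_trans le_less_trans)

lemma next_ord_eq_iff [simp]: "next_ord \<xi> = next_ord \<eta> \<longleftrightarrow> \<xi> = \<eta>"
  by (metis next_ord_less_iff linorder_neq_iff)

text \<open>Uniqueness for the \<open>THE\<close> in \<open>finite_part\<close>:
  \<open>next_ord\<close> is injective and its values are neither zero nor limits.\<close>

lemma finite_part_unique:
  assumes "zero_or_limit \<mu>" "zero_or_limit \<nu>" "(next_ord ^^ m) \<mu> = (next_ord ^^ n) \<nu>"
  shows "m = n"
  using assms
proof (induction m arbitrary: n)
  case 0
  then show ?case by (cases n) (auto simp: zero_or_limit_def)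
next
  case (Suc m)
  then show ?case by (cases n) (auto simp: zero_or_limit_def)
qed

lemma finite_part_eqI:
  assumes "zero_or_limit \<mu>"
  shows "finite_part ((next_ord ^^ n) \<mu>) = n"
  unfolding finite_part_def using assms finite_part_unique by blast

lemma finite_part_decomposition: "\<exists>\<mu> n. zero_or_limit \<mu> \<and> \<xi> = (next_ord ^^ n) \<mu>"
proof (induction \<xi> rule: less_induct)
  case (less \<xi>)
  show ?case
  proof (cases "zero_or_limit \<xi>")
    case True
    then show ?thesis by (metis funpow_0)
  next
    case False
    then obtain \<eta> where \<eta>: "\<xi> = next_ord \<eta>" by (auto simp: zero_or_limit_def)
    then obtain \<mu> n where "zero_or_limit \<mu>" "\<eta> = (next_ord ^^ n) \<mu>"
      using less[of \<eta>] next_ord_greater by blast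
    then have "\<xi> = (next_ord ^^ Suc n) \<mu>" using \<eta> by simp
    then show ?thesis using \<open>zero_or_limit \<mu>\<close> by blast
  qed
qed

lemma finite_part_next_ord: "finite_part (next_ord \<xi>) = Suc (finite_part \<xi>)"
proof -
  obtain \<mu> n where \<mu>: "zero_or_limit \<mu>" "\<xi> = (next_ord ^^ n) \<mu>"
    using finite_part_decomposition by blast
  then have "next_ord \<xi> = (next_ord ^^ Suc n) \<mu>" by simp
  then show ?thesis using \<mu> finite_part_eqI by metis
qed

lemma par_next_ord: "par (next_ord \<xi>) = 1 - par \<xi>"
  by (simp add: par_def finite_part_next_ord)

lemma par_0_or_1: "par \<xi> = 0 \<or> par \<xi> = 1"
  by (simp add: par_def)

text \<open>By induction such a map is the identity. This is why at most one ordinal fits the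
  description in \<open>rank_in\<close>.\<close>

lemma initial_segment_iso_eq:
  fixes g :: "omega1 \<Rightarrow> omega1"
  assumes bij: "bij_betw g {..<\<alpha>} {..<\<beta>}"
    and mono: "\<And>\<eta> \<zeta>. \<eta> < \<alpha> \<Longrightarrow> \<zeta> < \<alpha> \<Longrightarrow> \<eta> \<le> \<zeta> \<longleftrightarrow> g \<eta> \<le> g \<zeta>"
  shows "\<alpha> = \<beta>"
proof -
  have g_less: "g \<eta> < \<beta>" if "\<eta> < \<alpha>" for \<eta>
    using bij that by (auto dest: bij_betwE)
  have id: "\<eta> < \<alpha> \<Longrightarrow> g \<eta> = \<eta>" for \<eta>
  proof (induction \<eta> rule: less_induct)
    case (less \<eta>)
    have "\<not> g \<eta> < \<eta>"
    proof
      assume "g \<eta> < \<eta>"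
      then have "g (g \<eta>) = g \<eta>" "g \<eta> < \<alpha>" using less by auto
      then have "g \<eta> = \<eta>" using mono less.prems by (metis order_refl order_antisym)
      then show False using \<open>g \<eta> < \<eta>\<close> by simp
    qed
    moreover have "\<not> \<eta> < g \<eta>"
    proof
      assume "\<eta> < g \<eta>"
      then have "\<eta> < \<beta>" using g_less[OF less.prems] by simp
      then obtain \<zeta> where \<zeta>: "\<zeta> < \<alpha>" "g \<zeta> = \<eta>"
        using bij by (metis bij_betw_imp_surj_on imageE lessThan_iff)
      then have "\<zeta> < \<eta>"
        using mono[OF less.prems \<zeta>(1)] \<open>\<eta> < g \<eta>\<close> by (simp add: not_le[symmetric])
      then show False using less.IH[of \<zeta>] \<zeta> by simp
    qed
    ultimately show ?case by simp
  qed
  have "g ` {..<\<alpha>} = {..<\<alpha>}" using id by (simp add: image_cong)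
  then have "{..<\<alpha>} = {..<\<beta>}" using bij by (simp add: bij_betw_def)
  then show ?thesis by (metis lessThan_iff linorder_neq_iff order_less_irrefl)
qed

lemma Field_initial_segment:
  "Field {(\<alpha>, \<beta>). \<alpha> \<le> \<beta> \<and> \<beta> < (\<xi>::omega1)} = {..<\<xi>}"
  by (fastforce simp: Field_def)

lemma Well_order_initial_segment:
  "Well_order {(\<alpha>, \<beta>). \<alpha> \<le> \<beta> \<and> \<beta> < (\<xi>::omega1)}" (is "Well_order ?s")
proof -
  have "wf (?s - Id)"
    by (rule wf_subset[OF wf]) auto
  then show ?thesis
    unfolding Field_initial_segment
    by (auto simp: order_on_defs refl_on_def trans_def antisym_def total_on_def)
qed

section \<open>Well-orders of the natural numbers and their ranks\<close>

lemma well_order_on_UNIV_iff: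
  "well_order_on UNIV r \<longleftrightarrow>
    refl r \<and> trans r \<and> antisym r \<and> total r \<and> wf (r - Id)"
  by (auto simp: order_on_defs)

lemma well_order_total:
  assumes "well_order_on UNIV r" "(m, n) \<notin> r"
  shows "(n, m) \<in> r" "n \<noteq> m"
proof -
  have "refl r" "total r" using assms(1) by (auto simp: well_order_on_UNIV_iff)
  then show "n \<noteq> m" using assms(2) by (auto dest: reflD)
  then show "(n, m) \<in> r" using \<open>total r\<close> assms(2) by (auto simp: total_on_def)
qed

text \<open>Since no value below \<open>f n\<close> is skipped, \<open>f\<close> restricts to an
  isomorphism from the predecessors of \<open>n\<close> onto the ordinals below
  \<open>f n\<close>.\<close>

lemma rank_in_eq:
  assumes wo: "well_order_on UNIV r"
    and mono: "\<And>i j. (i, j) \<in> r \<longleftrightarrow> f i \<le> f j"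
    and surj: "\<And>\<xi>. \<xi> < f n \<Longrightarrow> \<xi> \<in> range f"
  shows "rank_in r n = f n"
proof -
  let ?s = "\<lambda>\<xi>. {(\<alpha>, \<beta>). \<alpha> \<le> \<beta> \<and> \<beta> < (\<xi>::omega1)}"
  let ?t = "Restr r (underS r n)"
  have inj: "inj f"
    using wo mono unfolding well_order_on_UNIV_iff inj_def antisym_def
    by (metis order_refl)
  have under: "m \<in> underS r n \<longleftrightarrow> f m < f n" for m
    using inj by (auto simp: underS_def mono less_le dest: injD)
  have WO: "Well_order r"
    using wo well_order_on_Field[OF wo] by metis
  have FT: "Field ?t = underS r n"
    unfolding Field_def by (auto simp: mono)
  have t: "Well_order ?t" using WO by (rule Well_order_Restr)
  have "bij_betw f (underS r n) {..<f n}"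
    unfolding bij_betw_def
  proof
    show "inj_on f (underS r n)" using inj by (rule inj_on_subset) simp
    show "f ` underS r n = {..<f n}"
    proof
      show "f ` underS r n \<subseteq> {..<f n}" by (simp add: image_subset_iff under)
      show "{..<f n} \<subseteq> f ` underS r n"
      proof
        fix \<xi> assume "\<xi> \<in> {..<f n}"
        then obtain m where "\<xi> = f m" "f m < f n" using surj by blast
        then show "\<xi> \<in> f ` underS r n" using under by blast
      qed
    qed
  qed
  then have "iso ?t (?s (f n)) f"
    unfolding iso_iff2 FT Field_initial_segment by (auto simp: mono under)
  then have iso: "(?t, ?s (f n)) \<in> ordIso"
    unfolding ordIso_def using t Well_order_initial_segment by blast
  have "\<xi> = f n" if "(?t, ?s \<xi>) \<in> ordIso" for \<xi>
  proof -
    have "(?s \<xi>, ?s (f n)) \<in> ordIso"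
      using ordIso_transitive[OF ordIso_symmetric[OF that] iso] .
    then obtain g where "iso (?s \<xi>) (?s (f n)) g" unfolding ordIso_def by auto
    then show ?thesis
      unfolding iso_iff2 Field_initial_segment
      by (intro initial_segment_iso_eq[of g]) auto
  qed
  then show ?thesis unfolding rank_in_def using iso by blast
qed

text \<open>Recursion along \<open>r\<close> sends \<open>n\<close> to the least ordinal strictly
  above the values at its strict predecessors; minimality rules out gaps.\<close>

lemma well_order_rank_exists:
  assumes wo: "well_order_on UNIV (r :: nat rel)"
  shows "\<exists>f :: nat \<Rightarrow> omega1. (\<forall>i j. (i, j) \<in> r \<longleftrightarrow> f i \<le> f j) \<and>
    (\<forall>n \<xi>. \<xi> < f n \<longrightarrow> \<xi> \<in> range f)"
proof -
  have wf: "wf (r - Id)" using wo by (simp add: well_order_on_UNIV_iff)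
  define F where "F = (\<lambda>(f :: nat \<Rightarrow> omega1) n. LEAST \<xi>. \<forall>m. (m, n) \<in> r - Id \<longrightarrow> f m < \<xi>)"
  define f where "f = wfrec (r - Id) F"
  have f_eq: "f n = (LEAST \<xi>. \<forall>m. (m, n) \<in> r - Id \<longrightarrow> f m < \<xi>)" for n
    unfolding f_def
    by (subst wfrec[OF wf]) (simp add: F_def cut_def cong: conj_cong imp_cong)
  have less: "f m < f n" if "(m, n) \<in> r - Id" for m n
  proof -
    \<comment> \<open>The \<open>LEAST\<close> is attained because the countable range of
      \<open>f\<close> is bounded in \<open>omega1\<close>.\<close>
    obtain \<xi> where "\<forall>\<eta>\<in>range f. \<eta> < \<xi>"
      using countable_bounded_omega1[of "range f"] by auto
    then have "\<forall>m. (m, n) \<in> r - Id \<longrightarrow> f m < \<xi>" by blast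
    then have "\<forall>m. (m, n) \<in> r - Id \<longrightarrow> f m < f n"
      by (subst (2) f_eq) (rule LeastI)
    then show ?thesis using that by blast
  qed
  have mono: "(i, j) \<in> r \<longleftrightarrow> f i \<le> f j" for i j
  proof (cases "i = j")
    case True
    then show ?thesis using wo by (simp add: well_order_on_UNIV_iff refl_on_def)
  next
    case False
    then show ?thesis
      using less[of i j] less[of j i] well_order_total[OF wo, of i j] by fastforce
  qed
  have "\<xi> < f n \<longrightarrow> \<xi> \<in> range f" for n \<xi>
    using wf
  proof (induction n rule: wf_induct_rule)
    case (less n)
    show ?case
    proof
      assume "\<xi> < f n"
      then have "\<not> (\<forall>m. (m, n) \<in> r - Id \<longrightarrow> f m < \<xi>)"
        by (subst (asm) f_eq) (rule not_less_Least)
      then obtain m where "(m, n) \<in> r - Id" "\<xi> \<le> f m" by (auto simp: not_less)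
      then show "\<xi> \<in> range f" using less[of m] by (cases "\<xi> = f m") auto
    qed
  qed
  then show ?thesis using mono by blast
qed

section \<open>Parity of ranks expressed by quantifiers over numbers\<close>

definition immediate_pred :: "nat rel \<Rightarrow> nat \<Rightarrow> nat \<Rightarrow> bool" where
  "immediate_pred r m n \<longleftrightarrow>
    (m, n) \<in> r \<and> m \<noteq> n \<and> (\<forall>k. (k, n) \<in> r \<longrightarrow> k = n \<or> (k, m) \<in> r)"

text \<open>For a well-order \<open>r\<close>, this says that the rank of \<open>n\<close> has
  finite part \<open>k\<close>. With quantifiers over numbers only, it is both analytic and
  coanalytic in a code of \<open>r\<close>.\<close>

fun succ_of_limit :: "nat \<Rightarrow> nat rel \<Rightarrow> nat \<Rightarrow> bool" where
  "succ_of_limit 0 r n \<longleftrightarrow> (\<forall>m. \<not> immediate_pred r m n)"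
| "succ_of_limit (Suc k) r n \<longleftrightarrow> (\<exists>m. immediate_pred r m n \<and> succ_of_limit k r m)"

definition odd_rank :: "nat rel \<Rightarrow> nat \<Rightarrow> bool" where
  "odd_rank r n \<longleftrightarrow> (\<exists>k. odd k \<and> succ_of_limit k r n)"

text \<open>A rank function without gaps turns immediate predecessors into ordinal predecessors, so
  \<open>succ_of_limit\<close> computes the finite part; some \<open>k\<close> exists because ranks
  cannot descend forever.\<close>

lemma par_rank_in_iff:
  assumes wo: "well_order_on UNIV r"
  shows "par (rank_in r n) = 1 \<longleftrightarrow> odd_rank r n"
proof -
  obtain f :: "nat \<Rightarrow> omega1" where mono: "\<And>i j. (i, j) \<in> r \<longleftrightarrow> f i \<le> f j"
    and surj: "\<And>n \<xi>. \<xi> < f n \<Longrightarrow> \<xi> \<in> range f"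
    using well_order_rank_exists[OF wo] by blast
  have inj: "inj f"
    using wo mono unfolding well_order_on_UNIV_iff inj_def antisym_def
    by (metis order_refl)
  have pred: "immediate_pred r m n \<longleftrightarrow> f n = next_ord (f m)" for m n
  proof
    assume p: "immediate_pred r m n"
    then have "f m < f n"
      using inj by (auto simp: immediate_pred_def mono less_le dest: injD)
    then have le: "next_ord (f m) \<le> f n" by (simp add: next_ord_le_iff)
    show "f n = next_ord (f m)"
    proof (rule ccontr)
      assume "f n \<noteq> next_ord (f m)"
      then have lt: "next_ord (f m) < f n" using le by simp
      \<comment> \<open>As \<open>f\<close> has no gaps below \<open>f n\<close>, this
        \<open>k\<close> would lie strictly between \<open>m\<close> and \<open>n\<close>.\<close>
      then obtain k where "f k = next_ord (f m)" using surj by fastforce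
      then show False
        using p lt next_ord_greater[of "f m"] unfolding immediate_pred_def mono
        by (metis less_le_not_le)
    qed
  next
    assume "f n = next_ord (f m)"
    then show "immediate_pred r m n"
      using next_ord_greater[of "f m"] inj unfolding immediate_pred_def mono
      by (metis injD le_less next_ord_le_iff not_less)
  qed
  have no_pred: "zero_or_limit (f n)" if "\<forall>m. \<not> immediate_pred r m n" for n
    unfolding zero_or_limit_def
  proof (intro allI notI)
    fix \<eta> assume "f n = next_ord \<eta>"
    then have "\<eta> \<in> range f" using surj[of \<eta> n] next_ord_greater[of \<eta>] by simp
    then obtain m where "\<eta> = f m" by blast
    then show False using \<open>f n = next_ord \<eta>\<close> that pred by blast
  qed
  have fp: "succ_of_limit k r n \<Longrightarrow> finite_part (f n) = k" for k n
  proof (induction k arbitrary: n)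
    case 0
    then show ?case using no_pred[of n] finite_part_eqI[of "f n" 0] by simp
  next
    case (Suc k)
    then show ?case by (auto simp: pred finite_part_next_ord)
  qed
  have ex: "\<exists>k. succ_of_limit k r n" for n
  proof (induction "f n" arbitrary: n rule: less_induct)
    case less
    show ?case
    proof (cases "\<exists>m. immediate_pred r m n")
      case True
      then obtain m where m: "immediate_pred r m n" by blast
      then have "f m < f n" using pred next_ord_greater by metis
      then obtain k where "succ_of_limit k r m" using less by blast
      then show ?thesis using m by (metis succ_of_limit.simps(2))
    next
      case False
      then show ?thesis by (metis succ_of_limit.simps(1))
    qed
  qed
  have "rank_in r n = f n" using rank_in_eq[OF wo mono surj] .
  then show ?thesis using fp ex[of n] by (auto simp: par_def odd_rank_def)
qed

section \<open>Closure properties of the projective classes\<close>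

lemma clopen_Collect_nat:
  fixes f :: "'a::topological_space \<Rightarrow> nat"
  assumes "continuous_on UNIV f"
  shows "open {x. P (f x)}" "closed {x. P (f x)}"
proof -
  have vim: "{x. Q (f x)} = f -` {n. Q n}" for Q by auto
  show op: "open {x. P (f x)}" for P
    unfolding vim by (rule open_vimage[OF open_discrete assms])
  have "- {x. P (f x)} = {x. \<not> P (f x)}" by auto
  then show "closed {x. P (f x)}" using op[of "\<lambda>n. \<not> P n"] by (simp add: closed_def)
qed

lemma continuous_on_coordinate:
  fixes g :: "'a::topological_space \<Rightarrow> 'b \<Rightarrow> 'c::topological_space"
  assumes "continuous_on UNIV g"
  shows "continuous_on UNIV (\<lambda>x. g x i)"
  using assms by (rule continuous_on_product_then_coordinatewise)

lemma continuous_on_fst_coordinate [simp]: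
    "continuous_on UNIV (\<lambda>p::baire \<times> 'a::topological_space. fst p i)"
  and continuous_on_snd_coordinate [simp]: "continuous_on UNIV (\<lambda>p::'a \<times> baire. snd p i)"
  by (rule continuous_on_coordinate[OF continuous_on_fst[OF continuous_on_id]],
      rule continuous_on_coordinate[OF continuous_on_snd[OF continuous_on_id]])

lemma open_Collect_bounded_all:
  assumes "finite A" "\<And>a. a \<in> A \<Longrightarrow> open {x. P a x}"
  shows "open {x. \<forall>a\<in>A. P a x}"
proof -
  have "{x. \<forall>a\<in>A. P a x} = (\<Inter>a\<in>A. {x. P a x})" by auto
  moreover have "open (\<Inter>a\<in>A. {x. P a x})" using assms by (intro open_INT) auto
  ultimately show ?thesis by simp
qed

section \<open>Analytic and coanalytic sets under preimages and countable operations\<close>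

lemma Sigma11_iff:
  "{z. P z} \<in> Sigma11 \<longleftrightarrow> (\<exists>Q. closed {p. Q (fst p) (snd p)} \<and> (\<forall>z. P z \<longleftrightarrow> (\<exists>u::baire. Q z u)))"
proof
  assume "{z. P z} \<in> Sigma11"
  then obtain C :: "(baire \<times> baire) set" where "closed C" "{z. P z} = fst ` C"
    by (auto simp: Sigma11_def)
  then have "closed {p. (fst p, snd p) \<in> C} \<and> (\<forall>z. P z \<longleftrightarrow> (\<exists>u. (z, u) \<in> C))"
    by force
  then show "\<exists>Q. closed {p. Q (fst p) (snd p)} \<and> (\<forall>z. P z \<longleftrightarrow> (\<exists>u::baire. Q z u))"
    by (intro exI[of _ "\<lambda>z u. (z, u) \<in> C"])
next
  assume "\<exists>Q. closed {p. Q (fst p) (snd p)} \<and> (\<forall>z. P z \<longleftrightarrow> (\<exists>u::baire. Q z u))"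
  then obtain Q where "closed {p. Q (fst p) (snd p)}" "\<And>z. P z \<longleftrightarrow> (\<exists>u::baire. Q z u)"
    by blast
  moreover from this have "{z. P z} = fst ` {p. Q (fst p) (snd p)}"
    unfolding image_def by (intro Collect_cong) auto
  ultimately show "{z. P z} \<in> Sigma11" unfolding Sigma11_def by blast
qed

lemma Pi11_iff: "{z. P z} \<in> Pi11 \<longleftrightarrow> {z. \<not> P z} \<in> Sigma11"
proof -
  have "{z. P z} = - {z. \<not> P z}" by auto
  then show ?thesis unfolding Pi11_def dual_def by (metis image_iff double_compl)
qed

lemma Sigma11_not: "{z. P z} \<in> Pi11 \<Longrightarrow> {z. \<not> P z} \<in> Sigma11"
  and Pi11_not: "{z. P z} \<in> Sigma11 \<Longrightarrow> {z. \<not> P z} \<in> Pi11"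
  by (simp_all add: Pi11_iff)

lemma Sigma11_vimage:
  assumes f: "continuous_on UNIV f" and "{z. P z} \<in> Sigma11"
  shows "{z. P (f z)} \<in> Sigma11"
proof -
  obtain Q where Q: "closed {p. Q (fst p) (snd p)}" "\<And>z. P z \<longleftrightarrow> (\<exists>u::baire. Q z u)"
    using assms(2) unfolding Sigma11_iff by blast
  have "continuous_on UNIV (\<lambda>p::baire \<times> baire. f (fst p))"
    by (rule continuous_on_compose2[OF f]) (auto intro: continuous_intros)
  then have "continuous_on UNIV (\<lambda>p::baire \<times> baire. (f (fst p), snd p))"
    by (intro continuous_on_Pair continuous_on_snd continuous_on_id)
  from closed_vimage[OF Q(1) this] have "closed {p. Q (f (fst p)) (snd p)}"
    by (simp add: vimage_def)
  then show ?thesis unfolding Sigma11_iff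
    using Q(2) by (intro exI[of _ "\<lambda>z. Q (f z)"]) auto
qed

lemma Pi11_vimage:
  assumes "continuous_on UNIV f" and "{z. P z} \<in> Pi11"
  shows "{z. P (f z)} \<in> Pi11"
  using assms Sigma11_vimage[of f "\<lambda>z. \<not> P z"] by (simp add: Pi11_iff)

lemma Sigma11_closed: "closed {z. P z} \<Longrightarrow> {z. P z} \<in> Sigma11"
proof -
  assume "closed {z. P z}"
  then have "closed ({z. P z} \<times> (UNIV :: baire set))" by (intro closed_Times) auto
  then have "closed {p::baire \<times> baire. P (fst p)}"
    by (rule back_subst[of closed]) auto
  then show ?thesis unfolding Sigma11_iff by (intro exI[of _ "\<lambda>z u. P z"]) auto
qed

text \<open>One point carries both the index, in its first entry, and the analytic witness, in the
  others.\<close>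

lemma Sigma11_ex:
  fixes P :: "'i::countable \<Rightarrow> baire \<Rightarrow> bool"
  assumes "\<And>i. {z. P i z} \<in> Sigma11"
  shows "{z. \<exists>i. P i z} \<in> Sigma11"
proof -
  have "\<forall>i. \<exists>Q. closed {p. Q (fst p) (snd p)} \<and> (\<forall>z. P i z \<longleftrightarrow> (\<exists>u::baire. Q z u))"
    using assms unfolding Sigma11_iff by blast
  then obtain Q where Q: "\<And>i. closed {p. Q i (fst p) (snd p)}"
      "\<And>i z. P i z \<longleftrightarrow> (\<exists>u::baire. Q i z u)"
    by metis
  \<comment> \<open>Quantifying over the value of \<open>u 0\<close> leaves, for each fixed
    \<open>n\<close>, a clopen premise and a closed conclusion.\<close>
  define R where "R z u \<longleftrightarrow> (\<forall>n. u 0 = n \<longrightarrow> Q (from_nat n) z (\<lambda>j. u (Suc j)))" for z and u :: baire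
  have "closed {p. R (fst p) (snd p)}"
    unfolding R_def
  proof (intro closed_Collect_all closed_Collect_imp)
    fix n
    show "open {p::baire \<times> baire. snd p 0 = n}" by (rule clopen_Collect_nat) simp
    have "continuous_on UNIV (\<lambda>p::baire \<times> baire. (fst p, \<lambda>j. snd p (Suc j)))"
      by (intro continuous_intros) simp
    from closed_vimage[OF Q(1) this]
    show "closed {p::baire \<times> baire. Q (from_nat n) (fst p) (\<lambda>j. snd p (Suc j))}"
      by (simp add: vimage_def)
  qed
  moreover have "(\<exists>i. P i z) \<longleftrightarrow> (\<exists>u. R z u)" for z
  proof
    assume "\<exists>i. P i z"
    then obtain i u where "Q i z u" using Q(2) by blast
    then have "R z (case_nat (to_nat i) u)" by (simp add: R_def)
    then show "\<exists>u. R z u" by blast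
  qed (auto simp: R_def Q(2))
  ultimately show ?thesis unfolding Sigma11_iff by blast
qed

text \<open>Witnesses for all indices are packed as the rows of a single point.\<close>

lemma Sigma11_all:
  fixes P :: "'i::countable \<Rightarrow> baire \<Rightarrow> bool"
  assumes "\<And>i. {z. P i z} \<in> Sigma11"
  shows "{z. \<forall>i. P i z} \<in> Sigma11"
proof -
  have "\<forall>i. \<exists>Q. closed {p. Q (fst p) (snd p)} \<and> (\<forall>z. P i z \<longleftrightarrow> (\<exists>u::baire. Q z u))"
    using assms unfolding Sigma11_iff by blast
  then obtain Q where Q: "\<And>i. closed {p. Q i (fst p) (snd p)}"
      "\<And>i z. P i z \<longleftrightarrow> (\<exists>u::baire. Q i z u)"
    by metis
  define R where "R z u \<longleftrightarrow> (\<forall>i::'i. Q i z (\<lambda>j. u (prod_encode (to_nat i, j))))" for z and u :: baire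
  have "closed {p. R (fst p) (snd p)}"
    unfolding R_def
  proof (intro closed_Collect_all)
    fix i :: 'i
    have "continuous_on UNIV (\<lambda>p::baire \<times> baire. (fst p, \<lambda>j. snd p (prod_encode (to_nat i, j))))"
      by (intro continuous_intros) simp
    from closed_vimage[OF Q(1) this]
    show "closed {p::baire \<times> baire. Q i (fst p) (\<lambda>j. snd p (prod_encode (to_nat i, j)))}"
      by (simp add: vimage_def)
  qed
  moreover have "(\<forall>i. P i z) \<longleftrightarrow> (\<exists>u. R z u)" for z
  proof
    assume "\<forall>i. P i z"
    then have "\<forall>i. \<exists>u. Q i z u" using Q(2) by blast
    then obtain u where "\<And>i. Q i z (u i)" by metis
    then have "R z (\<lambda>m. case prod_decode m of (i, j) \<Rightarrow> u (from_nat i) j)"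
      by (simp add: R_def)
    then show "\<exists>u. R z u" by blast
  qed (auto simp: R_def Q(2))
  ultimately show ?thesis unfolding Sigma11_iff by blast
qed

lemma Pi11_ex:
  fixes P :: "'i::countable \<Rightarrow> baire \<Rightarrow> bool"
  shows "(\<And>i. {z. P i z} \<in> Pi11) \<Longrightarrow> {z. \<exists>i. P i z} \<in> Pi11"
  using Sigma11_all[of "\<lambda>i z. \<not> P i z"] by (simp add: Pi11_iff)

lemma Pi11_all:
  fixes P :: "'i::countable \<Rightarrow> baire \<Rightarrow> bool"
  shows "(\<And>i. {z. P i z} \<in> Pi11) \<Longrightarrow> {z. \<forall>i. P i z} \<in> Pi11"
  using Sigma11_ex[of "\<lambda>i z. \<not> P i z"] by (simp add: Pi11_iff)

lemma Sigma11_const: "{z. c} \<in> Sigma11"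
  by (rule Sigma11_closed) simp

lemma Pi11_const: "{z. c} \<in> Pi11"
  by (simp only: Pi11_iff Sigma11_const)

lemma Sigma11_conj:
  assumes "{z. P z} \<in> Sigma11" "{z. Q z} \<in> Sigma11"
  shows "{z. P z \<and> Q z} \<in> Sigma11"
proof -
  have "{z. if b then P z else Q z} \<in> Sigma11" for b using assms by (cases b) simp_all
  from Sigma11_all[of "\<lambda>b z. if b then P z else Q z", OF this] show ?thesis by (simp add: all_bool_eq)
qed

lemma Sigma11_disj:
  assumes "{z. P z} \<in> Sigma11" "{z. Q z} \<in> Sigma11"
  shows "{z. P z \<or> Q z} \<in> Sigma11"
proof -
  have "{z. if b then P z else Q z} \<in> Sigma11" for b using assms by (cases b) simp_all
  from Sigma11_ex[of "\<lambda>b z. if b then P z else Q z", OF this] show ?thesis by (simp add: ex_bool_eq)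
qed

lemma Pi11_conj:
  assumes "{z. P z} \<in> Pi11" "{z. Q z} \<in> Pi11"
  shows "{z. P z \<and> Q z} \<in> Pi11"
  using Sigma11_disj[of "\<lambda>z. \<not> P z" "\<lambda>z. \<not> Q z"] assms by (simp add: Pi11_iff)

lemma Pi11_disj:
  assumes "{z. P z} \<in> Pi11" "{z. Q z} \<in> Pi11"
  shows "{z. P z \<or> Q z} \<in> Pi11"
  using Sigma11_conj[of "\<lambda>z. \<not> P z" "\<lambda>z. \<not> Q z"] assms by (simp add: Pi11_iff)

lemma Sigma11_imp:
  assumes "{z. P z} \<in> Pi11" "{z. Q z} \<in> Sigma11"
  shows "{z. P z \<longrightarrow> Q z} \<in> Sigma11"
  unfolding imp_conv_disj by (intro Sigma11_disj Sigma11_not assms)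

lemma Pi11_imp:
  assumes "{z. P z} \<in> Sigma11" "{z. Q z} \<in> Pi11"
  shows "{z. P z \<longrightarrow> Q z} \<in> Pi11"
  unfolding imp_conv_disj by (intro Pi11_disj Pi11_not assms)

lemma Pi11_iff_const:
  assumes "{z. P z} \<in> Sigma11" "{z. P z} \<in> Pi11"
  shows "{z. P z \<longleftrightarrow> c} \<in> Pi11"
  using assms by (cases c) (simp_all add: Pi11_iff)

lemma Sigma11_coordinate: "{z. z i = c} \<in> Sigma11"
  by (intro Sigma11_closed clopen_Collect_nat) simp

lemma Pi11_coordinate: "{z. z i = c} \<in> Pi11"
  unfolding Pi11_iff by (intro Sigma11_closed clopen_Collect_nat) simp

lemmas pointclass_intros =
  Sigma11_not Pi11_not Sigma11_ex Pi11_ex Sigma11_all Pi11_all Sigma11_conj Pi11_conj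
  Sigma11_disj Pi11_disj Sigma11_imp Pi11_imp Pi11_iff_const
  Sigma11_const Pi11_const

section \<open>Complexity of the ingredients of the witness\<close>

lemma Sigma11_coded_rel: "{y. (i, j) \<in> coded_rel y} \<in> Sigma11"
  and Pi11_coded_rel: "{y. (i, j) \<in> coded_rel y} \<in> Pi11"
  by (simp_all add: coded_rel_def Sigma11_coordinate Pi11_coordinate)

text \<open>Only well-foundedness needs a quantifier over Baire space: an infinite descending
  sequence is an analytic witness of its failure.\<close>

lemma Pi11_coded_well_order: "{y. well_order_on UNIV (coded_rel y)} \<in> Pi11"
proof -
  have "{y. \<exists>u. \<forall>i. (u (Suc i), u i) \<in> coded_rel y - Id} \<in> Sigma11"
    unfolding Sigma11_iff
  proof (intro exI conjI allI)
    \<comment> \<open>Naming the values of \<open>u\<close> by \<open>a\<close> and \<open>b\<close>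
      fixes the coordinate of \<open>y\<close> to inspect, so closedness can be read off clause by
      clause.\<close>
    let ?Q = "\<lambda>y (u::baire). \<forall>i a b. u (Suc i) = a \<longrightarrow> u i = b \<longrightarrow> y (prod_encode (a, b)) = 0 \<and> a \<noteq> b"
    show "closed {p::baire \<times> baire. ?Q (fst p) (snd p)}"
      by (intro closed_Collect_all closed_Collect_imp closed_Collect_conj clopen_Collect_nat) simp_all
    show "(\<exists>u. \<forall>i. (u (Suc i), u i) \<in> coded_rel y - Id) \<longleftrightarrow> (\<exists>u. ?Q y u)" for y
      by (simp add: coded_rel_def)
  qed
  then show ?thesis
    unfolding well_order_on_UNIV_iff wf_iff_no_infinite_down_chain refl_on_def trans_def
      antisym_def total_on_def ball_UNIV
    by (intro pointclass_intros Sigma11_coded_rel Pi11_coded_rel)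
qed

lemma
  shows Sigma11_immediate_pred: "{y. immediate_pred (coded_rel y) m n} \<in> Sigma11"
    and Pi11_immediate_pred: "{y. immediate_pred (coded_rel y) m n} \<in> Pi11"
  unfolding immediate_pred_def
  by (intro pointclass_intros Sigma11_coded_rel Pi11_coded_rel)+

lemma
  shows Sigma11_succ_of_limit: "{y. succ_of_limit k (coded_rel y) n} \<in> Sigma11"
    and Pi11_succ_of_limit: "{y. succ_of_limit k (coded_rel y) n} \<in> Pi11"
proof -
  have "{y. succ_of_limit k (coded_rel y) n} \<in> Sigma11 \<and>
    {y. succ_of_limit k (coded_rel y) n} \<in> Pi11"
  proof (induction k arbitrary: n)
    case 0
    show ?case unfolding succ_of_limit.simps
      by (intro conjI pointclass_intros Sigma11_immediate_pred Pi11_immediate_pred)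
  next
    case (Suc k)
    show ?case unfolding succ_of_limit.simps
      by (intro conjI pointclass_intros Sigma11_immediate_pred Pi11_immediate_pred
          Suc[THEN conjunct1] Suc[THEN conjunct2])
  qed
  then show "{y. succ_of_limit k (coded_rel y) n} \<in> Sigma11"
    "{y. succ_of_limit k (coded_rel y) n} \<in> Pi11" by blast+
qed

lemma
  shows Sigma11_odd_rank: "{y. odd_rank (coded_rel y) n} \<in> Sigma11"
    and Pi11_odd_rank: "{y. odd_rank (coded_rel y) n} \<in> Pi11"
  unfolding odd_rank_def
  by (intro pointclass_intros Sigma11_succ_of_limit Pi11_succ_of_limit)+

lemma Pi11_coded_Pi11: "{x. n \<in> coded_Pi11 x} \<in> Pi11"
  unfolding Pi11_iff Sigma11_iff
proof (intro exI conjI allI)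
  \<comment> \<open>\<open>t\<close> stands in for the prefix of \<open>u\<close>, so that a fixed
    coordinate of \<open>x\<close> is inspected.\<close>
  let ?Q = "\<lambda>x (u::baire). \<forall>k t. (\<forall>i\<in>{..<k}. u i = t i) \<longrightarrow> x (list_encode (n # map t [0..<k])) = 0"
  show "closed {p::baire \<times> baire. ?Q (fst p) (snd p)}"
    by (intro closed_Collect_all closed_Collect_imp open_Collect_bounded_all clopen_Collect_nat) simp_all
  have "(\<forall>k. x (list_encode (n # map u [0..<k])) = 0) \<longleftrightarrow> ?Q x u" for x u :: baire
  proof
    assume *: "\<forall>k. x (list_encode (n # map u [0..<k])) = 0"
    show "?Q x u"
    proof (intro allI impI)
      fix k and t :: baire
      assume "\<forall>i\<in>{..<k}. u i = t i"
      then have "map u [0..<k] = map t [0..<k]" by auto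
      then show "x (list_encode (n # map t [0..<k])) = 0" using * by metis
    qed
  qed auto
  then show "n \<notin> coded_Pi11 x \<longleftrightarrow> (\<exists>u. ?Q x u)" for x
    by (auto simp: coded_Pi11_def)
qed

definition tree_of :: "baire \<Rightarrow> nat \<Rightarrow> nat list set" where
  "tree_of x n = {s. x (list_encode (n # s)) = 0}"

text \<open>\<open>u\<close> is a strategy whose next move depends on the opponent's play so far;
  hence \<open>track u\<close> preserves lengths and initial segments.\<close>

definition track :: "baire \<Rightarrow> nat list \<Rightarrow> nat list" where
  "track u s = map (\<lambda>i. u (list_encode (take (Suc i) s))) [0..<length s]"

text \<open>Compares ranks of trees by a length-preserving map, coded by one point of Baire space.
  All prefixes are tested because \<open>tree_of x n\<close> need not be closed under initial
  segments.\<close>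

definition simulated :: "nat list set \<Rightarrow> nat list set \<Rightarrow> bool" where
  "simulated T T' \<longleftrightarrow> (\<exists>u. \<forall>s. (\<forall>k\<in>{..length s}. take k s \<in> T) \<longrightarrow> track u s \<in> T')"

text \<open>The strategy is the analytic witness; hence the negated simulations in
  \<open>records\<close> are coanalytic.\<close>

lemma Sigma11_simulated: "{x. simulated (tree_of x m) (tree_of x n)} \<in> Sigma11"
  unfolding Sigma11_iff
proof (intro exI conjI allI)
  let ?Q = "\<lambda>x (u::baire). \<forall>s t. (\<forall>k\<in>{..length s}. x (list_encode (m # take k s)) = 0) \<longrightarrow>
    (\<forall>i\<in>{..<length s}. u (list_encode (take (Suc i) s)) = t i) \<longrightarrow>
    x (list_encode (n # map t [0..<length s])) = 0"
  show "closed {p::baire \<times> baire. ?Q (fst p) (snd p)}"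
    by (intro closed_Collect_all closed_Collect_imp open_Collect_bounded_all clopen_Collect_nat) simp_all
  have "(\<forall>s. (\<forall>k\<in>{..length s}. take k s \<in> tree_of x m) \<longrightarrow> track u s \<in> tree_of x n) \<longleftrightarrow> ?Q x u"
    (is "?L \<longleftrightarrow> _") for x u
  proof
    assume L: ?L
    show "?Q x u"
    proof (intro allI impI)
      fix s t
      assume "\<forall>k\<in>{..length s}. x (list_encode (m # take k s)) = 0"
        and t: "\<forall>i\<in>{..<length s}. u (list_encode (take (Suc i) s)) = t i"
      then have "track u s \<in> tree_of x n" using L by (simp add: tree_of_def)
      moreover have "track u s = map t [0..<length s]" using t by (auto simp: track_def)
      ultimately show "x (list_encode (n # map t [0..<length s])) = 0"
        by (simp add: tree_of_def)
    qed
  next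
    assume "?Q x u"
    then show ?L by (auto simp: tree_of_def track_def)
  qed
  then show "simulated (tree_of x m) (tree_of x n) \<longleftrightarrow> (\<exists>u. ?Q x u)" for x
    unfolding simulated_def by blast
qed

section \<open>The witness is decided by finitely many mind changes\<close>

lemma track_map:
  "track u (map b [0..<k]) = map (\<lambda>i. u (list_encode (map b [0..<Suc i]))) [0..<k]"
  by (auto simp: track_def take_map simp del: upt_Suc)

lemma track_Cons:
  "track u (i # s) = u (list_encode [i]) # track (\<lambda>c. u (list_encode (i # list_decode c))) s"
  unfolding track_def by (simp add: upt_conv_Cons map_Suc_upt[symmetric] del: upt_Suc)

text \<open>The strategy, played against a branch of \<open>T\<close>, answers with a branch of
  \<open>T'\<close>.\<close>

lemma simulated_branch:
  assumes "simulated T T'" and b: "\<And>k. map b [0..<k] \<in> T"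
  shows "\<exists>b'. \<forall>k. map b' [0..<k] \<in> T'"
proof -
  obtain u where u: "\<And>s. \<forall>k\<in>{..length s}. take k s \<in> T \<Longrightarrow> track u s \<in> T'"
    using assms(1) unfolding simulated_def by blast
  have "track u (map b [0..<k]) \<in> T'" for k
    by (rule u) (simp add: take_map b)
  then show ?thesis unfolding track_map by blast
qed

definition subtree :: "nat list set \<Rightarrow> nat \<Rightarrow> nat list set" where
  "subtree T i = {s. i # s \<in> T}"

text \<open>Contrapositively, simulations of every \<open>subtree T i\<close> in some subtree of
  \<open>T'\<close> glue to a simulation of \<open>T\<close>.\<close>

lemma not_simulated_step:
  assumes "\<not> simulated T T'"
  shows "[] \<in> T \<and> ([] \<in> T' \<longrightarrow> (\<exists>i. \<forall>j. \<not> simulated (subtree T i) (subtree T' j)))"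
proof (rule ccontr)
  assume neg: "\<not> ?thesis"
  show False
  proof (cases "[] \<in> T")
    case False
    \<comment> \<open>The empty prefix is always tested, so without the root the condition is
      vacuous.\<close>
    then have "simulated T T'" unfolding simulated_def by force
    then show False using assms by simp
  next
    case True
    then have nil: "[] \<in> T'" and "\<forall>i. \<exists>j. simulated (subtree T i) (subtree T' j)"
      using neg by auto
    then obtain j where "\<forall>i. simulated (subtree T i) (subtree T' (j i))" by metis
    then obtain u where u: "\<And>i s. \<forall>k\<in>{..length s}. take k s \<in> subtree T i \<Longrightarrow>
        track (u i) s \<in> subtree T' (j i)"
      unfolding simulated_def by metis
    \<comment> \<open>The first move \<open>i\<close> is answered by \<open>j i\<close>; afterwards
      \<open>u i\<close> plays on the rest. The value at the empty list is never read by
      \<open>track\<close>.\<close>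
    define v where "v = (\<lambda>c. case list_decode c of [] \<Rightarrow> 0
      | i # s \<Rightarrow> if s = [] then j i else u i (list_encode s))"
    have v: "track v (i # s) = j i # track (u i) s" for i s
      unfolding track_Cons by (auto simp: track_def v_def)
    have "track v s \<in> T'" if s: "\<forall>k\<in>{..length s}. take k s \<in> T" for s
    proof (cases s)
      case Nil
      then show ?thesis using nil by (simp add: track_def)
    next
      case (Cons i s')
      have "take k s' \<in> subtree T i" if "k \<le> length s'" for k
        using s[THEN bspec, of "Suc k"] that Cons by (simp add: subtree_def)
      then have "track (u i) s' \<in> subtree T' (j i)" by (intro u) simp
      then show ?thesis by (simp add: Cons v subtree_def)
    qed
    then have "simulated T T'" unfolding simulated_def by blast
    then show False using assms by simp
  qed
qed

text \<open>Since \<open>T\<close> fails to be simulated in a well-founded \<open>T'\<close> only if the rank of \<open>T\<close> exceeds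
  that of \<open>T'\<close>, this says that there is no infinite descending sequence of ranks; the argument
  produces the branch directly, without ranks.\<close>

lemma not_simulated_chain:
  assumes "\<And>i. \<not> simulated (T i) (T (Suc i))"
  shows "\<exists>b. \<forall>k. map b [0..<k] \<in> T (0::nat)"
proof -
  define good where "good U \<longleftrightarrow> (\<forall>i. \<not> simulated (U i) (U (Suc i)))" for U :: "nat \<Rightarrow> nat list set"
  have step: "\<exists>c. good (\<lambda>i. subtree (U i) (c i))" if "good U" for U
  proof -
    have "[] \<in> U i" for i
      using that not_simulated_step unfolding good_def by blast
    \<comment> \<open>Each \<open>c\<close> works against every \<open>j\<close>, in particular
      against the choice made in the next tree, so all trees descend simultaneously.\<close>
    then have "\<forall>i. \<exists>c. \<forall>j. \<not> simulated (subtree (U i) c) (subtree (U (Suc i)) j)"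
      using that not_simulated_step unfolding good_def by blast
    then obtain c where "\<forall>i j. \<not> simulated (subtree (U i) (c i)) (subtree (U (Suc i)) j)"
      by metis
    then show ?thesis unfolding good_def by blast
  qed
  have "\<exists>f. f 0 = T \<and> (\<forall>k. good (f k) \<and> (\<exists>c. f (Suc k) = (\<lambda>i. subtree (f k i) (c i))))"
  proof -
    have "\<exists>f. \<forall>k. (good (f k) \<and> (k = 0 \<longrightarrow> f k = T)) \<and>
        (\<exists>c. f (Suc k) = (\<lambda>i. subtree (f k i) (c i)))"
    proof (rule dependent_nat_choice)
      show "\<exists>U. good U \<and> (0 = (0::nat) \<longrightarrow> U = T)" using assms by (auto simp: good_def)
      show "\<exists>U'. (good U' \<and> (Suc k = 0 \<longrightarrow> U' = T)) \<and>
          (\<exists>c. U' = (\<lambda>i. subtree (U i) (c i)))" if "good U \<and> (k = 0 \<longrightarrow> U = T)" for U k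
        using step[of U] that by auto
    qed
    then show ?thesis by blast
  qed
  then obtain f c where f0: "f 0 = T" and good: "\<And>k. good (f k)"
      and fS: "\<And>k. f (Suc k) = (\<lambda>i. subtree (f k i) (c k i))"
    by metis
  \<comment> \<open>The branch consists of the moves chosen in the tree with index 0.\<close>
  have "map (\<lambda>k. c k 0) [0..<k] @ s \<in> T 0 \<longleftrightarrow> s \<in> f k 0" for k s
  proof (induction k arbitrary: s)
    case (Suc k)
    then show ?case by (simp add: fS subtree_def)
  qed (simp add: f0)
  moreover have "[] \<in> f k 0" for k
    using good[of k] not_simulated_step unfolding good_def by blast
  ultimately have "map (\<lambda>k. c k 0) [0..<k] \<in> T 0" for k
    by (metis append_Nil2)
  then show ?thesis by (intro exI[of _ "\<lambda>k. c k 0"]) simp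
qed

section \<open>Records and mind changes\<close>

lemma coded_Pi11_iff_tree:
  "n \<in> coded_Pi11 x \<longleftrightarrow> (\<nexists>b. \<forall>k. map b [0..<k] \<in> tree_of x n)"
  by (auto simp: coded_Pi11_def tree_of_def)

text \<open>Those elements that enter \<open>P\<^sub>x\<close> before all their \<open>r\<close>-predecessors, where the stage at
  which \<open>n\<close> enters is the rank of \<open>tree_of x n\<close>.\<close>

definition records :: "nat rel \<Rightarrow> baire \<Rightarrow> nat set" where
  "records r x = {n \<in> coded_Pi11 x.
     \<forall>m. (m, n) \<in> r \<longrightarrow> m \<noteq> n \<longrightarrow> \<not> simulated (tree_of x m) (tree_of x n)}"

lemma well_order_least_exists:
  assumes wo: "well_order_on UNIV r" and "A \<noteq> {}"
  shows "\<exists>n\<in>A. \<forall>m\<in>A. (n, m) \<in> r"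
proof -
  have "wf (r - Id)" using wo by (simp add: well_order_on_UNIV_iff)
  then obtain n where "n \<in> A" "\<And>m. (m, n) \<in> r - Id \<Longrightarrow> m \<notin> A"
    using assms(2) wfE_min[of "r - Id"] by blast
  then show ?thesis using well_order_total[OF wo] by blast
qed

text \<open>A smaller \<open>m\<close> lies outside \<open>coded_Pi11 x\<close>, so its tree has a
  branch, which a simulation would carry into the branchless tree of \<open>n\<close>.\<close>

lemma least_in_records:
  assumes "n \<in> coded_Pi11 x" "\<forall>m\<in>coded_Pi11 x. (n, m) \<in> r" "antisym r"
  shows "n \<in> records r x"
  unfolding records_def
proof (intro CollectI conjI allI impI notI assms(1))
  fix m assume m: "(m, n) \<in> r" "m \<noteq> n" and sim: "simulated (tree_of x m) (tree_of x n)"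
  have "m \<notin> coded_Pi11 x" using m assms(2,3) by (meson antisymD)
  then show False
    using simulated_branch[OF sim] assms(1) unfolding coded_Pi11_iff_tree by blast
qed

text \<open>An infinite \<open>r\<close>-increasing sequence of records would be a chain of failed
  simulations, contradicting \<open>not_simulated_chain\<close>. So the records are well-ordered in
  both directions, hence finite.\<close>

lemma finite_records:
  assumes wo: "well_order_on UNIV r"
  shows "finite (records r x)"
proof (rule ccontr)
  define V where "V = records r x"
  assume "infinite (records r x)"
  then have inf: "infinite V" by (simp add: V_def)
  define above where "above = {(m, n). m \<in> V \<and> n \<in> V \<and> (n, m) \<in> r - Id}"
  have "wf above"
    unfolding wf_iff_no_infinite_down_chain
  proof
    assume "\<exists>f. \<forall>i. (f (Suc i), f i) \<in> above"
    then obtain f where f: "\<And>i. (f (Suc i), f i) \<in> above" by blast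
    then have "\<not> simulated (tree_of x (f i)) (tree_of x (f (Suc i)))" for i
      using f[of i] by (auto simp: above_def V_def records_def)
    then have "\<exists>b. \<forall>k. map b [0..<k] \<in> tree_of x (f 0)"
      by (rule not_simulated_chain)
    moreover have "f 0 \<in> coded_Pi11 x"
      using f[of 0] by (auto simp: above_def V_def records_def)
    ultimately show False by (simp add: coded_Pi11_iff_tree)
  qed
  \<comment> \<open>Induction from the top: the records from \<open>v\<close> on are
    \<open>v\<close> and those from the next record \<open>v'\<close> on.\<close>
  then have fin: "v \<in> V \<Longrightarrow> finite {w \<in> V. (v, w) \<in> r}" for v
  proof (induction v rule: wf_induct_rule)
    case (less v)
    show ?case
    proof (cases "{w \<in> V. (v, w) \<in> r - Id} = {}")
      case True
      then have "{w \<in> V. (v, w) \<in> r} \<subseteq> {v}" by auto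
      then show ?thesis by (rule finite_subset) simp
    next
      case False
      then obtain v' where v': "v' \<in> V" "(v, v') \<in> r - Id"
          "\<And>w. w \<in> V \<Longrightarrow> (v, w) \<in> r - Id \<Longrightarrow> (v', w) \<in> r"
        using well_order_least_exists[OF wo False] by blast
      then have "finite {w \<in> V. (v', w) \<in> r}"
        using less by (auto simp: above_def)
      moreover have "{w \<in> V. (v, w) \<in> r} \<subseteq> insert v {w \<in> V. (v', w) \<in> r}"
        using v' by auto
      ultimately show ?thesis using finite_subset by blast
    qed
  qed
  obtain v where "v \<in> V" "\<forall>w\<in>V. (v, w) \<in> r"
    using well_order_least_exists[OF wo, of V] inf by auto
  then have "V = {w \<in> V. (v, w) \<in> r}" by auto
  then show False using fin[OF \<open>v \<in> V\<close>] inf by simp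
qed

lemma least_in_eq:
  assumes "n \<in> S" "\<forall>m\<in>S. (n, m) \<in> r" "antisym r"
  shows "least_in r S = n"
  unfolding least_in_def using assms by (intro the_equality) (auto dest: antisymD)

lemma witness_fun_eq:
  assumes "well_order_on UNIV (coded_rel y)"
    and "n \<in> coded_Pi11 x" "\<forall>m\<in>coded_Pi11 x. (n, m) \<in> coded_rel y"
  shows "witness_fun x y = par (rank_in (coded_rel y) n)"
proof -
  have "least_in (coded_rel y) (coded_Pi11 x) = n"
    using assms by (intro least_in_eq) (simp_all add: well_order_on_UNIV_iff)
  then show ?thesis using assms by (auto simp: witness_fun_def)
qed

text \<open>The records are listed by decreasing rank, the order of discovery. Index 0 must have odd
  rank, since the initial guess is 0.\<close>

definition alternating :: "nat rel \<Rightarrow> baire \<Rightarrow> nat list \<Rightarrow> bool" where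
  "alternating r x ns \<longleftrightarrow>
     (\<forall>i. i < length ns \<longrightarrow> ns ! i \<in> records r x \<and> (odd_rank r (ns ! i) \<longleftrightarrow> even i)) \<and>
     (\<forall>i j. i < j \<longrightarrow> j < length ns \<longrightarrow> (ns ! j, ns ! i) \<in> r \<and> ns ! j \<noteq> ns ! i)"

text \<open>The number of mind changes about the parity of the least element of \<open>P\<^sub>x\<close>, starting from the
  guess \<open>0\<close>, is the maximal length of an alternating sequence.\<close>

definition mind_changes :: "nat \<Rightarrow> (baire \<times> baire) set" where
  "mind_changes k = {(x, y). k = 0 \<or>
     well_order_on UNIV (coded_rel y) \<and> (\<exists>ns. length ns = k \<and> alternating (coded_rel y) x ns)}"

lemma alternating_take: "alternating r x ns \<Longrightarrow> alternating r x (take k ns)"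
  by (auto simp: alternating_def)

lemma alternating_length:
  assumes "well_order_on UNIV r" "alternating r x ns"
  shows "length ns \<le> card (records r x)"
proof -
  have "distinct ns"
    using assms(2) unfolding alternating_def distinct_conv_nth by (metis linorder_neqE_nat)
  moreover have "set ns \<subseteq> records r x"
    using assms(2) by (auto simp: alternating_def in_set_conv_nth)
  ultimately show ?thesis
    using card_mono[OF finite_records[OF assms(1)]] by (metis distinct_card)
qed

lemma mind_changes_antimono: "mind_changes (Suc k) \<subseteq> mind_changes k"
proof
  fix p assume "p \<in> mind_changes (Suc k)"
  then obtain x y ns where p: "p = (x, y)" "well_order_on UNIV (coded_rel y)"
      "length ns = Suc k" "alternating (coded_rel y) x ns"
    by (auto simp: mind_changes_def)
  then have "length (take k ns) = k" "alternating (coded_rel y) x (take k ns)"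
    by (simp_all add: alternating_take)
  then show "p \<in> mind_changes k" using p by (auto simp: mind_changes_def)
qed

text \<open>In a decreasing list the least record could only be the last entry, whose parity differs
  from that of \<open>v\<close>.\<close>

lemma alternating_append_least:
  assumes alt: "alternating r x ns" and anti: "antisym r"
    and v: "v \<in> records r x" "\<forall>w\<in>records r x. (v, w) \<in> r"
    and par: "odd_rank r v \<longleftrightarrow> even (length ns)"
  shows "alternating r x (ns @ [v])"
proof -
  have "v \<noteq> ns ! i" if i: "i < length ns" for i
  proof
    assume eq: "v = ns ! i"
    have "i \<noteq> length ns - 1"
      using alt i par eq by (auto simp: alternating_def)
    then have "i < length ns - 1" using i by simp
    then have "(ns ! (length ns - 1), v) \<in> r" "ns ! (length ns - 1) \<noteq> v"
      using alt i eq by (auto simp: alternating_def)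
    moreover have "ns ! (length ns - 1) \<in> records r x"
      using alt i by (auto simp: alternating_def)
    ultimately show False using v(2) anti by (meson antisymD)
  qed
  moreover have "(v, ns ! i) \<in> r" if "i < length ns" for i
    using alt v(2) that by (auto simp: alternating_def)
  ultimately show ?thesis
    using alt v(1) par unfolding alternating_def nth_append by (auto simp: less_Suc_eq)
qed

text \<open>\<open>N\<close> is the maximal length. If the least element had the wrong parity, it
  could be appended to an alternating sequence of length \<open>N\<close>.\<close>

lemma mind_changes_parity:
  "\<exists>N. (\<forall>k. (x, y) \<in> mind_changes k \<longleftrightarrow> k \<le> N) \<and> (witness_fun x y = 1 \<longleftrightarrow> odd N)"
proof (cases "well_order_on UNIV (coded_rel y)")
  case False
  \<comment> \<open>The clause \<open>k = 0\<close> keeps such pairs at level 0 exactly, matching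
    the default value of the witness.\<close>
  then show ?thesis
    by (intro exI[of _ 0]) (auto simp: mind_changes_def witness_fun_def)
next
  case wo: True
  let ?r = "coded_rel y"
  have anti: "antisym ?r" using wo by (simp add: well_order_on_UNIV_iff)
  define K where "K = {k. (x, y) \<in> mind_changes k}"
  have "k \<le> card (records ?r x)" if "k \<in> K" for k
    using that alternating_length[OF wo] by (auto simp: K_def mind_changes_def)
  then have fin: "finite K" by (meson finite_nat_set_iff_bounded_le)
  have "0 \<in> K" by (simp add: K_def mind_changes_def)
  define N where "N = Max K"
  have "N \<in> K" using fin \<open>0 \<in> K\<close> unfolding N_def by (intro Max_in) auto
  have down: "k \<in> K" if "k \<le> l" "l \<in> K" for k l
    using that(1,2)
  proof (induction l rule: dec_induct)
    case (step l)
    then show ?case using mind_changes_antimono by (auto simp: K_def)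
  qed
  have N: "(x, y) \<in> mind_changes k \<longleftrightarrow> k \<le> N" for k
    using down[OF _ \<open>N \<in> K\<close>] Max_ge[OF fin] unfolding N_def K_def by blast
  have "alternating ?r x []" by (simp add: alternating_def)
  then obtain ns where ns: "length ns = N" "alternating ?r x ns"
    using \<open>N \<in> K\<close> by (cases "N = 0") (auto simp: K_def mind_changes_def)
  have "witness_fun x y = 1 \<longleftrightarrow> odd N"
  proof (cases "coded_Pi11 x = {}")
    case True
    then have "N = 0" using ns by (cases "N = 0") (auto simp: alternating_def records_def)
    then show ?thesis using True by (simp add: witness_fun_def)
  next
    case False
    then obtain v where v: "v \<in> coded_Pi11 x" "\<forall>m\<in>coded_Pi11 x. (v, m) \<in> ?r"
      using well_order_least_exists[OF wo] by blast
    have "witness_fun x y = 1 \<longleftrightarrow> odd_rank ?r v"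
      using witness_fun_eq[OF wo v] par_rank_in_iff[OF wo] by simp
    moreover have "odd_rank ?r v \<longleftrightarrow> odd N"
    proof (rule ccontr)
      assume "\<not> ?thesis"
      then have "alternating ?r x (ns @ [v])"
        using v ns anti least_in_records[OF v anti]
        by (intro alternating_append_least) (auto simp: records_def)
      moreover have "length (ns @ [v]) = Suc N" by (simp add: ns)
      ultimately have "(x, y) \<in> mind_changes (Suc N)"
        using wo unfolding mind_changes_def by blast
      then show False using N by simp
    qed
    ultimately show ?thesis by simp
  qed
  then show ?thesis using N by blast
qed

text \<open>Lists form a countable type, simulations occur only negated, and the order and rank
  parities lie in both classes.\<close>

lemma Pi11_mind_changes: "{z. (\<lambda>n. z (2 * n), \<lambda>n. z (2 * n + 1)) \<in> mind_changes k} \<in> Pi11"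
proof -
  have x: "continuous_on UNIV (\<lambda>(z::baire) n. z (2 * n))"
    and y: "continuous_on UNIV (\<lambda>(z::baire) n. z (2 * n + 1))"
    by (intro continuous_on_coordinatewise_then_product continuous_on_product_coordinates)+
  show ?thesis
    unfolding mind_changes_def alternating_def records_def mem_Collect_eq case_prod_conv
    by (intro pointclass_intros Sigma11_vimage[OF x Sigma11_simulated] Pi11_vimage[OF x Pi11_coded_Pi11]
        Sigma11_vimage[OF y Sigma11_coded_rel] Pi11_vimage[OF y Pi11_coded_rel]
        Sigma11_vimage[OF y Sigma11_odd_rank] Pi11_vimage[OF y Pi11_odd_rank]
        Pi11_vimage[OF y Pi11_coded_well_order])
qed

section \<open>The witness and its complement as decreasing differences\<close>

lemma mem_dual_iff: "S \<in> dual \<Gamma> \<longleftrightarrow> - S \<in> \<Gamma>"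
  unfolding dual_def by (metis image_iff double_compl)

lemma witness_set_in_Delta: "witness_set \<in> Delta (Dstar_omega Pi11)"
proof -
  define B where "B k = {z. (\<lambda>n. z (2 * n), \<lambda>n. z (2 * n + 1)) \<in> mind_changes k}" for k
  have dec: "decseq B"
    unfolding decseq_Suc_iff B_def using mind_changes_antimono by blast
  have Pi: "B k \<in> Pi11" for k unfolding B_def by (rule Pi11_mind_changes)
  have N: "\<exists>N. (\<forall>k. z \<in> B k \<longleftrightarrow> k \<le> N) \<and> (z \<in> witness_set \<longleftrightarrow> odd N)" for z
    using mind_changes_parity[of "\<lambda>n. z (2 * n)" "\<lambda>n. z (2 * n + 1)"]
    by (simp add: B_def witness_set_def)
  \<comment> \<open>An odd \<open>N\<close> gives the even index \<open>N - 1\<close> in the shifted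
    sequence; the unshifted one selects even \<open>N\<close>, that is, the complement.\<close>
  have "witness_set = decr_diff (\<lambda>k. B (Suc k))"
  proof (intro set_eqI)
    fix z
    obtain N where N: "\<And>k. z \<in> B k \<longleftrightarrow> k \<le> N" "z \<in> witness_set \<longleftrightarrow> odd N" using N by blast
    have "z \<in> decr_diff (\<lambda>k. B (Suc k)) \<longleftrightarrow> (\<exists>n. even n \<and> Suc n = N)"
      by (auto simp: decr_diff_def N(1) not_less_eq_eq dest: antisym)
    also have "\<dots> \<longleftrightarrow> odd N" by (cases N) auto
    finally show "z \<in> witness_set \<longleftrightarrow> z \<in> decr_diff (\<lambda>k. B (Suc k))"
      using N(2) by simp
  qed
  moreover have "decseq (\<lambda>k. B (Suc k))" using dec by (auto simp: decseq_def)
  ultimately have "witness_set \<in> Dstar_omega Pi11"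
    unfolding Dstar_omega_def using Pi by blast
  moreover have "- witness_set = decr_diff B"
  proof (intro set_eqI)
    fix z
    obtain N where "\<forall>k. z \<in> B k \<longleftrightarrow> k \<le> N" "z \<in> witness_set \<longleftrightarrow> odd N" using N by blast
    then show "z \<in> - witness_set \<longleftrightarrow> z \<in> decr_diff B"
      by (auto simp: decr_diff_def dest: antisym not_less_eq_eq[THEN iffD1])
  qed
  then have "- witness_set \<in> Dstar_omega Pi11"
    unfolding Dstar_omega_def using Pi dec by blast
  ultimately show ?thesis by (simp add: Delta_def mem_dual_iff)
qed

section \<open>Reduction of the difference hierarchy to the witness\<close>

lemma tendsto_baire:
  fixes f :: "nat \<Rightarrow> baire"
  assumes "\<And>k i. i < k \<Longrightarrow> f k i = l i"
  shows "f \<longlonglongrightarrow> l"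
proof -
  have "(\<lambda>k. f k i) \<longlonglongrightarrow> l i" for i
    by (rule tendsto_eventually) (auto simp: assms intro: eventually_sequentiallyI[of "Suc i"])
  then have "limitin (product_topology (\<lambda>i. euclidean) UNIV) f l sequentially"
    unfolding limitin_componentwise by simp
  then show ?thesis unfolding euclidean_product_topology by simp
qed

text \<open>The approximating pairs converge to \<open>(z, u)\<close>. The prefix of
  \<open>z\<close> is longer by one because the coded lists in \<open>section_code\<close> carry the
  extra entry \<open>n\<close>.\<close>

lemma closed_prefix_approximation:
  assumes "closed {p. Q (fst p) (snd p)}"
    and "\<And>k. \<exists>z' u'. Q z' u' \<and> map z' [0..<Suc k] = map z [0..<Suc k] \<and> map u' [0..<k] = map u [0..<k]"
  shows "Q (z::baire) (u::baire)"
proof -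
  obtain z' u' where Q: "\<And>k. Q (z' k) (u' k)"
      and z': "\<And>k. map (z' k) [0..<Suc k] = map z [0..<Suc k]"
      and u': "\<And>k. map (u' k) [0..<k] = map u [0..<k]"
    using assms(2) by metis
  have "(\<lambda>k. (z' k, u' k)) \<longlonglongrightarrow> (z, u)"
  proof (intro tendsto_Pair tendsto_baire)
    show "z' k i = z i" if "i < k" for k i
      using z'[of k] that by (simp add: map_eq_conv)
    show "u' k i = u i" if "i < k" for k i
      using u'[of k] that by (simp add: map_eq_conv)
  qed
  then have "(z, u) \<in> {p. Q (fst p) (snd p)}"
    using Q by (intro Lim_in_closed_set[OF assms(1)]) auto
  then show ?thesis by simp
qed

text \<open>\<open>coded_Pi11 (section_code w z)\<close> is the section at \<open>z\<close> of the sequence of coanalytic sets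
  coded by \<open>w\<close>.\<close>

definition section_code :: "baire \<Rightarrow> baire \<Rightarrow> baire" where
  "section_code w z m = w (prod_encode (m, list_encode (map z [0..<length (list_decode m)])))"

lemma section_code_universal:
  fixes G :: "nat \<Rightarrow> baire set"
  assumes "\<And>n. G n \<in> Pi11"
  shows "\<exists>w. \<forall>z. coded_Pi11 (section_code w z) = {n. z \<in> G n}"
proof -
  have "\<forall>n. \<exists>Q. closed {p. Q (fst p) (snd p)} \<and> (\<forall>z. z \<notin> G n \<longleftrightarrow> (\<exists>u::baire. Q z u))"
    using assms Pi11_iff[of "\<lambda>z. z \<in> G _"] unfolding Sigma11_iff by simp
  then obtain Q where Q: "\<And>n. closed {p. Q n (fst p) (snd p)}"
      "\<And>n z. z \<notin> G n \<longleftrightarrow> (\<exists>u::baire. Q n z u)"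
    by metis
  \<comment> \<open>The basic open set given by \<open>t\<close> and \<open>s\<close> meets the
    closed relation \<open>Q n\<close>. The code \<open>w\<close> is 0 exactly where this is still
    possible, apart from the irrelevant empty list.\<close>
  define near where "near n s t \<longleftrightarrow>
    (\<exists>z' u'. Q n z' u' \<and> map z' [0..<length t] = t \<and> map u' [0..<length s] = s)" for n s t
  define w where "w = (\<lambda>c. case prod_decode c of (a, b) \<Rightarrow>
    case list_decode a of [] \<Rightarrow> 0 | n # s \<Rightarrow> if near n s (list_decode b) then 0 else (1::nat))"
  have w: "section_code w z (list_encode (n # map u [0..<k])) = 0 \<longleftrightarrow>
      near n (map u [0..<k]) (map z [0..<Suc k])" for z n u k
    by (simp add: section_code_def w_def del: upt_Suc list_encode.simps)
  have "(\<forall>k. near n (map u [0..<k]) (map z [0..<Suc k])) \<longleftrightarrow> Q n z u" for n u z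
    using closed_prefix_approximation[OF Q(1)[of n]]
    unfolding near_def length_map length_upt minus_nat.diff_0 by blast
  then have "n \<in> coded_Pi11 (section_code w z) \<longleftrightarrow> z \<in> G n" for n z
    using Q(2)[of z n] unfolding coded_Pi11_def mem_Collect_eq w by blast
  then show ?thesis by blast
qed

section \<open>Continuity of the coding maps\<close>

lemma continuous_on_prefix:
  fixes f :: "nat list \<Rightarrow> nat"
  shows "continuous_on UNIV (\<lambda>z::baire. f (map z [0..<k]))"
  unfolding continuous_on_open_vimage[OF open_UNIV]
proof (intro allI impI)
  fix B :: "nat set"
  have "(\<lambda>z. f (map z [0..<k])) -` B \<inter> UNIV =
      (\<Union>s\<in>{s. f (map ((!) s) [0..<k]) \<in> B}. {z. \<forall>i\<in>{..<k}. z i = s ! i})" (is "?L = ?R")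
  proof (intro set_eqI iffI)
    fix z assume "z \<in> ?L"
    moreover have "map ((!) (map z [0..<k])) [0..<k] = map z [0..<k]" by auto
    ultimately have "map z [0..<k] \<in> {s. f (map ((!) s) [0..<k]) \<in> B}" by (simp del: map_eq_conv)
    then show "z \<in> ?R" by (rule UN_I) simp
  next
    fix z assume "z \<in> ?R"
    then obtain s where s: "f (map ((!) s) [0..<k]) \<in> B" "\<forall>i\<in>{..<k}. z i = s ! i" by blast
    have "map z [0..<k] = map ((!) s) [0..<k]" using s(2) by simp
    then show "z \<in> ?L" using s(1) by (metis IntI UNIV_I vimageI)
  qed
  also have "open \<dots>"
    by (intro open_UN ballI open_Collect_bounded_all clopen_Collect_nat) simp_all
  finally show "open ((\<lambda>z. f (map z [0..<k])) -` B \<inter> UNIV)" .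
qed

lemma continuous_on_eval:
  fixes g :: "'a::topological_space \<Rightarrow> baire" and c :: "'a \<Rightarrow> nat"
  assumes "continuous_on UNIV g" "continuous_on UNIV c"
  shows "continuous_on UNIV (\<lambda>x. g x (c x))"
  unfolding continuous_on_open_vimage[OF open_UNIV]
proof (intro allI impI)
  fix B :: "nat set"
  have "(\<lambda>x. g x (c x)) -` B \<inter> UNIV = (\<Union>n. {x. c x = n} \<inter> {x. g x n \<in> B})" by auto
  also have "open \<dots>"
    using continuous_on_coordinate[OF assms(1)] assms(2)
    by (intro open_UN ballI open_Int clopen_Collect_nat)
  finally show "open ((\<lambda>x. g x (c x)) -` B \<inter> UNIV)" .
qed

definition interleave :: "baire \<Rightarrow> baire \<Rightarrow> baire" where
  "interleave x y k = (if even k then x (k div 2) else y (k div 2))"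

lemma interleave_in_witness_set: "interleave x y \<in> witness_set \<longleftrightarrow> witness_fun x y = 1"
  by (simp add: witness_set_def interleave_def)

lemma continuous_on_interleave:
  assumes "continuous_on UNIV f"
  shows "continuous_on UNIV (\<lambda>z. interleave (f z) y)"
proof (rule continuous_on_coordinatewise_then_product)
  show "continuous_on UNIV (\<lambda>z. interleave (f z) y k)" for k
    using continuous_on_coordinate[OF assms] by (cases "even k") (simp_all add: interleave_def)
qed

text \<open>Serves both a constant \<open>g\<close>, for the inclusion, and the identity, for the
  diagonal argument.\<close>

lemma continuous_on_section_code:
  assumes "continuous_on UNIV g"
  shows "continuous_on UNIV (\<lambda>z. section_code (g z) z)"
proof (rule continuous_on_coordinatewise_then_product)
  show "continuous_on UNIV (\<lambda>z. section_code (g z) z m)" for m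
    unfolding section_code_def
    by (intro continuous_on_eval[OF assms] continuous_on_prefix[where f = "\<lambda>s. prod_encode (m, list_encode s)"])
qed

text \<open>The code for \<open>z\<close> lists the positions of \<open>h \<eta>\<close> for the
  stages \<open>\<eta>\<close> with \<open>z \<in> A \<eta>\<close>, so the least position reveals
  the parity of the first such stage. One \<open>y\<close> serves all \<open>S\<close>, as the
  diagonal argument requires.\<close>

lemma D_level_reducible_to_witness:
  "\<exists>y. \<forall>S\<in>D_level \<xi> Pi11. \<exists>w. \<forall>z. interleave (section_code w z) y \<in> witness_set \<longleftrightarrow> z \<notin> S"
proof -
  \<comment> \<open>A default above every \<open>h \<eta>\<close>, least when \<open>z\<close> lies
    in no \<open>A \<eta>\<close>. Then \<open>z \<notin> S\<close>, so its parity must be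
    1.\<close>
  obtain \<zeta> where \<zeta>: "next_ord \<xi> \<le> \<zeta>" "par \<zeta> = 1"
  proof (cases "par (next_ord \<xi>) = 1")
    case False
    then have "par (next_ord (next_ord \<xi>)) = 1"
      using par_0_or_1[of "next_ord \<xi>"] par_next_ord[of "next_ord \<xi>"] by simp
    then show ?thesis using that next_ord_greater less_imp_le by blast
  qed (use that in blast)
  \<comment> \<open>Infinitely many ordinals are put below \<open>\<theta>\<close>, so that
    \<open>{..<\<theta>}\<close> is enumerated bijectively by all of \<open>nat\<close>.\<close>
  have "infinite (UNIV :: omega1 set)"
    using uncountable_omega1 countable_finite by blast
  then obtain g :: "nat \<Rightarrow> omega1" where g: "inj g"
    using infinite_countable_subset by blast
  obtain \<theta> where \<theta>: "\<forall>\<eta>\<in>insert \<zeta> (range g). \<eta> < \<theta>"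
    using countable_bounded_omega1[of "insert \<zeta> (range g)"] by auto
  have "range g \<subseteq> {..<\<theta>}" using \<theta> by auto
  then have "infinite {..<\<theta>}"
    using g range_inj_infinite infinite_super by blast
  then have e: "bij_betw (from_nat_into {..<\<theta>}) UNIV {..<\<theta>}"
    using bij_betw_from_nat_into countable_lessThan_omega1 by blast
  define e where "e = from_nat_into {..<\<theta>}"
  have inj: "inj e" and range: "range e = {..<\<theta>}"
    using e by (simp_all add: e_def bij_betw_def)
  define y where "y = (\<lambda>c. case prod_decode c of (i, j) \<Rightarrow> if e i \<le> e j then 0 else (1::nat))"
  have y: "(i, j) \<in> coded_rel y \<longleftrightarrow> e i \<le> e j" for i j
    by (simp add: coded_rel_def y_def)
  have wo: "well_order_on UNIV (coded_rel y)"
    unfolding well_order_on_UNIV_iff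
  proof (intro conjI)
    show "wf (coded_rel y - Id)"
    proof (rule wf_subset[OF wf_inv_image[OF wf, of e]])
      show "coded_rel y - Id \<subseteq> inv_image {(x, y). x < y} e"
        using inj by (auto simp: y inv_image_def less_le dest: injD)
    qed
    show "antisym (coded_rel y)"
      using inj by (auto simp: antisym_def y dest: injD order_antisym)
  qed (auto simp: refl_on_def trans_def total_on_def y)
  have rank: "rank_in (coded_rel y) n = e n" for n
  proof (rule rank_in_eq[OF wo y])
    fix \<alpha> assume "\<alpha> < e n"
    moreover have "e n < \<theta>" using range by blast
    ultimately show "\<alpha> \<in> range e" using range by auto
  qed
  \<comment> \<open>The shift makes the \<open>\<eta>\<close> that count for the difference of length \<open>\<xi>\<close> exactly those
      with \<open>h \<eta>\<close> even.\<close>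
  define h where "h = (if par \<xi> = 1 then id else next_ord)"
  have h_le: "h \<eta> \<le> h \<gamma> \<longleftrightarrow> \<eta> \<le> \<gamma>" for \<eta> \<gamma> by (simp add: h_def le_less)
  have h_par: "par (h \<eta>) = 1 \<longleftrightarrow> par \<eta> = par \<xi>" for \<eta>
    using par_0_or_1[of \<eta>] par_0_or_1[of \<xi>] by (auto simp: h_def par_next_ord)
  have h_\<zeta>: "h \<eta> < \<zeta>" if "\<eta> < \<xi>" for \<eta>
  proof -
    have "h \<eta> \<le> next_ord \<eta>" using next_ord_greater[of \<eta>] by (simp add: h_def less_imp_le)
    also have "\<dots> < next_ord \<xi>" using that by simp
    finally show ?thesis using \<zeta>(1) by simp
  qed
  show ?thesis
  proof (rule exI[of _ y], rule ballI)
    fix S assume "S \<in> D_level \<xi> Pi11"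
    then obtain A where S: "S = incr_diff \<xi> A" and A: "\<And>\<eta>. \<eta> < \<xi> \<Longrightarrow> A \<eta> \<in> Pi11"
      unfolding D_level_def by blast
    \<comment> \<open>The position of \<open>\<zeta>\<close> is always present, so the coded set is
      never empty.\<close>
    define G where "G n = {z. e n = \<zeta> \<or> (\<exists>m. e m < \<xi> \<and> e n = h (e m) \<and> z \<in> A (e m))}" for n
    have "{z. e m < \<xi> \<and> e n = h (e m) \<and> z \<in> A (e m)} \<in> Pi11" for n m
      using A[of "e m"] Pi11_const[of False] Pi11_conj[OF Pi11_const, of "\<lambda>z. z \<in> A (e m)"]
      by (cases "e m < \<xi>") simp_all
    then have "G n \<in> Pi11" for n
      unfolding G_def by (intro Pi11_disj Pi11_const Pi11_ex)
    then obtain w where w: "\<And>z. coded_Pi11 (section_code w z) = {n. z \<in> G n}"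
      using section_code_universal[of G] by blast
    have "interleave (section_code w z) y \<in> witness_set \<longleftrightarrow> z \<notin> S" for z
    proof (cases "\<exists>\<eta><\<xi>. z \<in> A \<eta>")
      case True
      define \<eta> where "\<eta> = (LEAST \<eta>. \<eta> < \<xi> \<and> z \<in> A \<eta>)"
      have \<eta>: "\<eta> < \<xi>" "z \<in> A \<eta>" using True unfolding \<eta>_def by (metis (lifting) LeastI_ex)+
      have \<eta>_le: "\<eta> \<le> \<gamma>" if "\<gamma> < \<xi>" "z \<in> A \<gamma>" for \<gamma>
        using that unfolding \<eta>_def by (intro Least_le) simp
      have "\<zeta> < \<theta>" using \<theta> by simp
      then have "\<eta> \<in> range e" "h \<eta> \<in> range e"
        using h_\<zeta>[OF \<eta>(1)] \<eta>(1) \<zeta>(1) next_ord_greater[of \<xi>] by (auto simp: range)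
      then obtain m n where mn: "e m = \<eta>" "e n = h \<eta>" unfolding image_iff by metis
      then have "z \<in> G n" using \<eta> unfolding G_def by auto
      moreover have "e n \<le> e k" if "z \<in> G k" for k
        using that h_\<zeta>[OF \<eta>(1)] \<eta>_le unfolding G_def by (auto simp: mn h_le)
      ultimately have "witness_fun (section_code w z) y = par (h \<eta>)"
        using witness_fun_eq[OF wo, of n "section_code w z"] by (simp add: w y rank mn)
      moreover have "z \<in> S \<longleftrightarrow> par \<eta> \<noteq> par \<xi>"
      proof
        assume "z \<in> S"
        then obtain \<gamma> where \<gamma>: "\<gamma> < \<xi>" "par \<gamma> \<noteq> par \<xi>" "z \<in> A \<gamma>" "\<And>\<delta>. \<delta> < \<gamma> \<Longrightarrow> z \<notin> A \<delta>"
          by (auto simp: S incr_diff_def)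
        then have "\<gamma> = \<eta>" using \<eta>_le[of \<gamma>] \<eta> by (metis le_less)
        then show "par \<eta> \<noteq> par \<xi>" using \<gamma> by simp
      next
        assume "par \<eta> \<noteq> par \<xi>"
        moreover have "z \<notin> A \<delta>" if "\<delta> < \<eta>" for \<delta>
          using \<eta>_le[of \<delta>] that \<eta>(1) by (meson less_trans not_less)
        ultimately show "z \<in> S" using \<eta> by (auto simp: S incr_diff_def)
      qed
      ultimately show ?thesis by (metis interleave_in_witness_set h_par)
    next
      case False
      have "\<zeta> \<in> range e" using \<theta> by (simp add: range)
      then obtain n where n: "e n = \<zeta>" by blast
      have "z \<in> G k \<longleftrightarrow> k = n" for k
        using False n inj by (auto simp: G_def dest: injD)
      then have "witness_fun (section_code w z) y = par \<zeta>"
        using witness_fun_eq[OF wo, of n "section_code w z"] by (simp add: w y rank n)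
      moreover have "z \<notin> S" using False by (auto simp: S incr_diff_def)
      ultimately show ?thesis using \<zeta>(2) by (simp add: interleave_in_witness_set)
    qed
    then show "\<exists>w. \<forall>z. interleave (section_code w z) y \<in> witness_set \<longleftrightarrow> z \<notin> S" by blast
  qed
qed

section \<open>Preimages, the inclusion and its properness\<close>

lemma Pi11_vimage_set: "continuous_on UNIV f \<Longrightarrow> S \<in> Pi11 \<Longrightarrow> f -` S \<in> Pi11"
  using Pi11_vimage[of f "\<lambda>z. z \<in> S"] by (simp add: vimage_def)

lemma D_level_vimage:
  assumes f: "continuous_on UNIV f" and "S \<in> D_level \<xi> Pi11"
  shows "f -` S \<in> D_level \<xi> Pi11"
proof -
  obtain A where A: "S = incr_diff \<xi> A" "mono_on {..<\<xi>} A" "\<forall>\<eta><\<xi>. A \<eta> \<in> Pi11"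
    using assms(2) unfolding D_level_def by blast
  have "f -` S = incr_diff \<xi> (\<lambda>\<eta>. f -` A \<eta>)"
    unfolding A incr_diff_def by blast
  moreover have "mono_on {..<\<xi>} (\<lambda>\<eta>. f -` A \<eta>)"
    using A(2) unfolding mono_on_def by blast
  ultimately show ?thesis
    unfolding D_level_def using A(3) Pi11_vimage_set[OF f] by blast
qed

lemma Dstar_omega_vimage:
  assumes f: "continuous_on UNIV f" and "S \<in> Dstar_omega Pi11"
  shows "f -` S \<in> Dstar_omega Pi11"
proof -
  obtain B where B: "S = decr_diff B" "decseq B" "\<forall>n. B n \<in> Pi11"
    using assms(2) unfolding Dstar_omega_def by blast
  have "f -` S = decr_diff (\<lambda>n. f -` B n)"
    unfolding B decr_diff_def by blast
  moreover have "decseq (\<lambda>n. f -` B n)"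
    using B(2) unfolding decseq_def by blast
  ultimately show ?thesis
    unfolding Dstar_omega_def using B(3) Pi11_vimage_set[OF f] by blast
qed

text \<open>\<open>S\<close> is the complement of a continuous preimage of the witness, and the
  target class is closed under both operations.\<close>

lemma Diff_class_subset: "Diff_class Pi11 \<subseteq> Delta (Dstar_omega Pi11)"
proof
  fix S assume "S \<in> Diff_class Pi11"
  then obtain \<xi> where \<xi>: "S \<in> D_level \<xi> Pi11" unfolding Diff_class_def by blast
  from D_level_reducible_to_witness[of \<xi>] obtain y
    where y: "\<forall>S\<in>D_level \<xi> Pi11. \<exists>w. \<forall>z. interleave (section_code w z) y \<in> witness_set \<longleftrightarrow> z \<notin> S" ..
  from bspec[OF y \<xi>] obtain w
    where wy: "\<forall>z. interleave (section_code w z) y \<in> witness_set \<longleftrightarrow> z \<notin> S" ..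
  define f where "f z = interleave (section_code w z) y" for z
  have f: "continuous_on UNIV f"
    unfolding f_def by (intro continuous_on_interleave continuous_on_section_code continuous_on_const)
  have "z \<in> f -` witness_set \<longleftrightarrow> z \<notin> S" for z
    unfolding f_def vimage_def mem_Collect_eq by (rule wy[THEN spec])
  then have "- S = f -` witness_set" "S = f -` (- witness_set)"
    by blast+
  moreover have "witness_set \<in> Dstar_omega Pi11" "- witness_set \<in> Dstar_omega Pi11"
    using witness_set_in_Delta by (simp_all add: Delta_def mem_dual_iff)
  ultimately show "S \<in> Delta (Dstar_omega Pi11)"
    using Dstar_omega_vimage[OF f] by (simp add: Delta_def mem_dual_iff)
qed

lemma witness_set_notin_Diff_class: "witness_set \<notin> Diff_class Pi11"
proof
  assume "witness_set \<in> Diff_class Pi11"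
  then obtain \<xi> where \<xi>: "witness_set \<in> D_level \<xi> Pi11" unfolding Diff_class_def by blast
  from D_level_reducible_to_witness[of \<xi>] obtain y
    where y: "\<forall>S\<in>D_level \<xi> Pi11. \<exists>w. \<forall>z. interleave (section_code w z) y \<in> witness_set \<longleftrightarrow> z \<notin> S" ..
  \<comment> \<open>The point \<open>z\<close> is both the code and the argument.\<close>
  define f where "f z = interleave (section_code z z) y" for z
  have "continuous_on UNIV f"
    unfolding f_def by (intro continuous_on_interleave continuous_on_section_code continuous_on_id)
  then have "f -` witness_set \<in> D_level \<xi> Pi11" using \<xi> by (rule D_level_vimage)
  from bspec[OF y this] obtain w
    where "\<forall>z. interleave (section_code w z) y \<in> witness_set \<longleftrightarrow> z \<notin> f -` witness_set" ..
  \<comment> \<open>At its own code \<open>w\<close>, the preimage would contain \<open>w\<close>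
    exactly if it did not.\<close>
  from this[THEN spec, of w] show False by (simp add: f_def)
qed

theorem theorem1p3:
  shows "Diff_class Pi11 \<subset> Delta (Dstar_omega Pi11) \<and>
         witness_set \<in> Delta (Dstar_omega Pi11) - Diff_class Pi11"
  using Diff_class_subset witness_set_in_Delta witness_set_notin_Diff_class by blast

end
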